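(* Let $T>0$ and $A:\mathbb{R}\to\mathbb{R}^{n\times n}$ continuous and $T$-periodic. The following are equivalent for the system $\dot{\mathbf x}=A(t)\mathbf x$: (a) the A-index of the system is zero; (b) there exist $R\in\mathbb{R}^{n\times n}$ and a $T$-periodic function $Q:\mathbb{R}\to\mathbb{R}^{n\times n}$ such that $Q(t)e^{tR}$ is a fundamental matrix solution of the system; (c) every fundamental matrix solution $\Phi(t)$ of the system admits a real Floquet normal form $\Phi(t)=P(t)e^{tB}$ with $B\in\mathbb{R}^{n\times n}$ and $P:\mathbb{R}\to\mathbb{R}^{n\times n}$ $T$-periodic.
   Context: For a fundamental matrix $\Phi$ of $\dot{\mathbf x}=A(t)\mathbf x$, the monodromy matrix is $\Phi^{-1}(0)\Phi(T)$; its Jordan normal form is independent of $\Phi$. The A-index of the system is the sum, over each distinct Jordan block of the Jordan normal form of a monodromy matrix that is associated to a real negative eigenvalue and occurs an odd number of times, of the dimension of that block (each such distinct block counted only once). *)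

theory Defs
  imports Complex_Main "Jordan_Normal_Form.Jordan_Normal_Form_Uniqueness"
begin

definition mat_exp :: "real mat \<Rightarrow> real mat" where
  "mat_exp R = mat (dim_row R) (dim_col R)
     (\<lambda>(i,j). (\<Sum>k. (R ^\<^sub>m k) $$ (i,j) / fact k))"

definition mat_inv :: "nat \<Rightarrow> real mat \<Rightarrow> real mat" where
  "mat_inv n M = (THE N. N \<in> carrier_mat n n \<and> M * N = 1\<^sub>m n \<and> N * M = 1\<^sub>m n)"

definition fundamental_matrix :: "nat \<Rightarrow> (real \<Rightarrow> real mat) \<Rightarrow> (real \<Rightarrow> real mat) \<Rightarrow> bool" where
  "fundamental_matrix n A \<Phi> \<longleftrightarrow>
     (\<forall>t. \<Phi> t \<in> carrier_mat n n \<and> invertible_mat (\<Phi> t)) \<and>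
     (\<forall>t i j. i < n \<longrightarrow> j < n \<longrightarrow>
        ((\<lambda>s. \<Phi> s $$ (i,j)) has_real_derivative (A t * \<Phi> t) $$ (i,j)) (at t))"

definition monodromy :: "nat \<Rightarrow> (real \<Rightarrow> real mat) \<Rightarrow> real \<Rightarrow> real mat" where
  "monodromy n \<Phi> T = mat_inv n (\<Phi> 0) * \<Phi> T"

definition jnf_A_index :: "(nat \<times> complex) list \<Rightarrow> nat" where
  "jnf_A_index n_as = sum fst {b \<in> set n_as.
       Im (snd b) = 0 \<and> Re (snd b) < 0 \<and> odd (count (mset n_as) b)}"

text \<open>A-index of the system x' = A(t) x with period T: computed from the
  (complex) Jordan normal form of the monodromy matrix of some fundamental
  matrix (it is independent of the choices, by uniqueness of the JNF and
  since monodromy matrices of different fundamental matrices are similar).\<close>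
definition A_index :: "nat \<Rightarrow> (real \<Rightarrow> real mat) \<Rightarrow> real \<Rightarrow> nat" where
  "A_index n A T =
     (let \<Phi> = (SOME \<Phi>. fundamental_matrix n A \<Phi>);
          M = map_mat complex_of_real (monodromy n \<Phi> T)
      in jnf_A_index (SOME n_as. jordan_nf M n_as))"

end

theory Submission
  imports Defs "Jordan_Normal_Form.Jordan_Normal_Form_Existence"
    "HOL-Analysis.Henstock_Kurzweil_Integration" "HOL-Analysis.Complex_Transcendental"
begin

hide_const (open) Finite_Cartesian_Product.mat

text \<open>
  A fundamental matrix satisfies \<open>\<Phi>(t + T) = \<Phi>(t) M\<close> with \<open>M\<close> its monodromy matrix, so it has a real
  Floquet normal form iff \<open>M\<close> has a real logarithm; different fundamental matrices have similar
  monodromy matrices, so this does not depend on \<open>\<Phi>\<close>.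

  If \<open>M = exp L\<close> with \<open>L\<close> real, each Jordan block \<open>(k, \<lambda>)\<close> of \<open>L\<close> becomes a block
  \<open>(k, exp \<lambda>)\<close> of \<open>M\<close>. The blocks of \<open>L\<close> are closed under conjugation, and those over a negative
  eigenvalue of \<open>M\<close> are not real, hence they come in pairs. Conversely, if the blocks for negative
  eigenvalues occur an even number of times, all blocks of \<open>M\<close> that are not for a positive
  eigenvalue can be paired as \<open>(k, \<mu>), (k, cnj \<mu>)\<close>, which is the exponential of a real matrix with
  blocks \<open>(k, Ln \<mu>), (k, cnj (Ln \<mu>))\<close>. This yields a real \<open>L\<close> such that \<open>exp L\<close> is similar to \<open>M\<close> over
  the complex numbers, and therefore over the reals.
\<close>

subsection \<open>Similarity and Jordan normal forms\<close>

lemma mult_mat_index_sum: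
  assumes "A \<in> carrier_mat n m" "B \<in> carrier_mat m p" "i < n" "j < p"
  shows "(A * B) $$ (i,j) = (\<Sum>l<m. A $$ (i,l) * B $$ (l,j))"
  using assms by (auto simp: scalar_prod_def atLeast0LessThan intro!: sum.cong)

lemma det_nonzero_inverse:
  fixes S :: "'a :: field mat"
  assumes S: "S \<in> carrier_mat n n" and d: "det S \<noteq> 0"
  obtains S' where "S' \<in> carrier_mat n n" "S * S' = 1\<^sub>m n" "S' * S = 1\<^sub>m n"
  using det_non_zero_imp_unit[OF S d, of "()"] that
  unfolding Units_def ring_mat_def by auto

lemma similar_mat_if_intertwined:
  fixes A :: "'a :: field mat"
  assumes A: "A \<in> carrier_mat n n" and B: "B \<in> carrier_mat n n" and S: "S \<in> carrier_mat n n"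
    and d: "det S \<noteq> 0" and eq: "A * S = S * B"
  shows "similar_mat A B"
proof -
  obtain S' where S': "S' \<in> carrier_mat n n" "S * S' = 1\<^sub>m n" "S' * S = 1\<^sub>m n"
    using det_nonzero_inverse[OF S d] .
  have "A = A * (S * S')" using A S' by simp
  also have "\<dots> = A * S * S'" using A S S' by simp
  finally have "A = S * B * S'" unfolding eq .
  thus ?thesis by (intro similar_matI[of _ _ S S' n]) (use A B S S' in auto)
qed

section \<open>Jordan normal forms: existence, uniqueness and order of the blocks\<close>

lemma jordan_nf_carrier:
  assumes "jordan_nf A n_as"
  shows "A \<in> carrier_mat (sum_list (map fst n_as)) (sum_list (map fst n_as))"
proof -
  from assms obtain P Q where "similar_mat_wit A (jordan_matrix n_as) P Q"
    unfolding jordan_nf_def similar_mat_def by auto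
  from similar_mat_witD(4,5)[OF refl this] show ?thesis
    using jordan_matrix_carrier[of n_as] by (metis carrier_matD(1))
qed

lemma complex_jordan_nf_exists:
  fixes A :: "complex mat"
  assumes "A \<in> carrier_mat n n"
  shows "\<exists>n_as. jordan_nf A n_as"
  using char_poly_factorized[OF assms] jordan_nf_exists[OF assms] by blast

text \<open>The number of blocks of size k > 0 for e is a combination of dimensions of generalised
  eigenspaces of A, so it depends on A alone. Blocks of size 0 are excluded by
  \<open>jordan_nf\<close>.\<close>

lemma jordan_nf_unique_mset:
  fixes A :: "'a :: field mat"
  assumes a: "jordan_nf A n_as" and b: "jordan_nf A m_bs"
  shows "mset n_as = mset m_bs"
proof (rule multiset_eqI)
  fix x :: "nat \<times> 'a"
  obtain k e where x: "x = (k,e)" by force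
  show "count (mset n_as) x = count (mset m_bs) x"
  proof (cases "k = 0")
    case True
    have "x \<notin> set n_as" "x \<notin> set m_bs" using a b unfolding jordan_nf_def x True by force+
    thus ?thesis by (simp add: count_eq_zero_iff[THEN iffD2])
  next
    case False
    show ?thesis
      using compute_nr_of_jordan_blocks[OF a False, of e] compute_nr_of_jordan_blocks[OF b False, of e]
      unfolding x by (simp add: count_mset count_list_eq_length_filter)
  qed
qed

text \<open>The conjugating matrix is the block permutation that exchanges the two coordinate
  subspaces.\<close>

lemma similar_mat_four_block_swap:
  fixes A :: "'a :: comm_ring_1 mat"
  assumes A: "A \<in> carrier_mat n n" and B: "B \<in> carrier_mat m m"
  shows "similar_mat (four_block_mat A (0\<^sub>m n m) (0\<^sub>m m n) B) (four_block_mat B (0\<^sub>m m n) (0\<^sub>m n m) A)"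
proof -
  let ?P = "four_block_mat (0\<^sub>m n m) (1\<^sub>m n) (1\<^sub>m m) (0\<^sub>m m n) :: 'a mat"
  let ?Q = "four_block_mat (0\<^sub>m m n) (1\<^sub>m m) (1\<^sub>m n) (0\<^sub>m n m) :: 'a mat"
  let ?B = "four_block_mat B (0\<^sub>m m n) (0\<^sub>m n m) A"
  have PQ: "?P * ?Q = 1\<^sub>m (n + m)"
    by (subst mult_four_block_mat[of _ n m _ n _ m _ _ n _ m]) auto
  have QP: "?Q * ?P = 1\<^sub>m (n + m)"
    by (subst mult_four_block_mat[of _ m n _ m _ n _ _ m _ n]) (auto simp: add.commute)
  have "?P * ?B = four_block_mat (0\<^sub>m n m) A B (0\<^sub>m m n)"
    by (subst mult_four_block_mat[of _ n m _ n _ m _ _ m _ n]) (use A B in auto)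
  also have "\<dots> * ?Q = four_block_mat A (0\<^sub>m n m) (0\<^sub>m m n) B"
    by (subst mult_four_block_mat[of _ n m _ n _ m _ _ n _ m]) (use A B in auto)
  finally show ?thesis
    by (intro similar_matI[OF _ PQ QP]) (use A B in \<open>auto simp: add.commute\<close>)
qed

lemma jordan_matrix_append:
  "jordan_matrix (xs @ ys) = four_block_mat (jordan_matrix xs)
     (0\<^sub>m (sum_list (map fst xs)) (sum_list (map fst ys)))
     (0\<^sub>m (sum_list (map fst ys)) (sum_list (map fst xs))) (jordan_matrix ys)"
proof -
  have "jordan_matrix (xs @ ys) = four_block_mat (jordan_matrix xs)
     (0\<^sub>m (dim_row (jordan_matrix xs)) (dim_col (jordan_matrix ys)))
     (0\<^sub>m (dim_row (jordan_matrix ys)) (dim_col (jordan_matrix xs))) (jordan_matrix ys)"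
    unfolding jordan_matrix_def map_append diag_block_mat_append Let_def ..
  thus ?thesis by (simp only: jordan_matrix_dim)
qed

text \<open>Rotations suffice: \<open>b1 @ x # b2\<close> is a rotation of
  \<open>x # b2 @ b1\<close>, which costs one exchange of two diagonal blocks, and the tails are
  handled by induction.\<close>

lemma jordan_matrix_similar_if_mset_eq:
  fixes xs :: "(nat \<times> 'a :: comm_ring_1) list"
  assumes "mset xs = mset ys"
  shows "similar_mat (jordan_matrix xs) (jordan_matrix ys)"
  using assms
proof (induction xs arbitrary: ys)
  case Nil
  thus ?case by (simp add: similar_mat_refl[OF jordan_matrix_carrier])
next
  case (Cons x xs)
  then obtain b1 b2 where ys: "ys = b1 @ x # b2"
    by (metis list.set_intros(1) set_mset_mset split_list)
  obtain k a where x: "x = (k,a)" by force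
  have ms: "mset xs = mset (b2 @ b1)" using Cons.prems unfolding ys by simp
  hence s: "sum_list (map fst (b2 @ b1)) = sum_list (map fst xs)"
    by (metis mset_map sum_mset_sum_list)
  have 1: "similar_mat (jordan_matrix (x # xs)) (jordan_matrix (x # b2 @ b1))"
    unfolding x jordan_matrix_Cons s
    by (rule similar_mat_four_block_0_0[OF similar_mat_refl Cons.IH[OF ms]]) auto
  have 2: "similar_mat (jordan_matrix ((x # b2) @ b1)) (jordan_matrix (b1 @ (x # b2)))"
    unfolding jordan_matrix_append by (rule similar_mat_four_block_swap) auto
  show ?case using similar_mat_trans[OF 1 2[simplified]] unfolding ys .
qed

lemma jordan_nf_mset:
  fixes A :: "'a :: comm_ring_1 mat"
  assumes "jordan_nf A xs" "mset xs = mset ys"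
  shows "jordan_nf A ys"
  using assms jordan_matrix_similar_if_mset_eq[OF assms(2)] similar_mat_trans mset_eq_setD[OF assms(2)]
  unfolding jordan_nf_def by metis

text \<open>Applying \<open>A - \<mu>\<close> repeatedly to the last unit vector produces a Jordan chain of full length.\<close>

lemma similar_jordan_block_if_superdiagonal_nonzero:
  fixes A :: "'a :: field mat"
  assumes A: "A \<in> carrier_mat n n"
    and ut: "\<And>i j. j < i \<Longrightarrow> i < n \<Longrightarrow> A $$ (i,j) = 0"
    and diag: "\<And>i. i < n \<Longrightarrow> A $$ (i,i) = \<mu>"
    and sup: "\<And>i. Suc i < n \<Longrightarrow> A $$ (i, Suc i) \<noteq> 0"
  shows "similar_mat A (jordan_block n \<mu>)"
proof -
  \<comment> \<open>\<open>u\<close> holds the entries of A - \<mu>, and \<open>w m\<close> is the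
    m-th power of A - \<mu> applied to the last unit vector.\<close>
  define u where "u = (\<lambda>i l. A $$ (i,l) - (if i = l then \<mu> else 0))"
  define w :: "nat \<Rightarrow> nat \<Rightarrow> 'a" where
    "w = rec_nat (\<lambda>i. if i = n - 1 then 1 else 0) (\<lambda>_ v i. \<Sum>l<n. u i l * v l)"
  have w0: "w 0 i = (if i = n - 1 then 1 else 0)" for i unfolding w_def by simp
  have wS: "w (Suc m) i = (\<Sum>l<n. u i l * w m l)" for m i unfolding w_def by simp
  have u0: "u i l = 0" if "l \<le> i" "i < n" for i l
    using that ut[of l i] diag[of i] unfolding u_def by (cases "l = i") auto
  \<comment> \<open>Each application of the strictly upper triangular \<open>u\<close> moves the
    last nonzero coordinate up by one. Thus \<open>w m\<close> ends at coordinate n - 1 - m, where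
    it is a product of superdiagonal entries and hence nonzero.\<close>
  have w_zero: "w m i = 0" if "i < n" "n \<le> i + m" for m i
    using that
  proof (induction m arbitrary: i)
    case (Suc m)
    have "u i l * w m l = 0" if "l < n" for l
      using u0[of l i] Suc.IH[of l] Suc.prems that by (cases "l \<le> i") auto
    thus ?case unfolding wS by (intro sum.neutral) auto
  qed (auto simp: w0)
  have w_nz: "w m i \<noteq> 0" if "i < n" "Suc (i + m) = n" for m i
    using that
  proof (induction m arbitrary: i)
    case (Suc m)
    have "u i l * w m l = 0" if "l < n" "l \<noteq> Suc i" for l
      using u0[of l i] w_zero[of l m] Suc.prems that by (cases "l \<le> i") auto
    hence "w (Suc m) i = (\<Sum>l\<in>{Suc i}. u i l * w m l)"
      unfolding wS by (intro sum.mono_neutral_right) (use Suc.prems in auto)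
    moreover have "u i (Suc i) \<noteq> 0" using sup[of i] Suc.prems by (simp add: u_def)
    moreover have "w m (Suc i) \<noteq> 0" using Suc.IH[of "Suc i"] Suc.prems by simp
    ultimately show ?case by simp
  qed (auto simp: w0)
  \<comment> \<open>The chain is read from right to left: the last column is the unit vector. With
    this offset column j ends exactly at coordinate j, so S is upper triangular with nonzero
    diagonal.\<close>
  define S where "S = mat n n (\<lambda>(i,j). w (n - Suc j) i)"
  have S: "S \<in> carrier_mat n n" unfolding S_def by simp
  have Sij: "S $$ (i,j) = w (n - Suc j) i" if "i < n" "j < n" for i j
    using that unfolding S_def by simp
  have "upper_triangular S"
    by (rule upper_triangularI) (use S in \<open>auto simp: Sij w_zero\<close>)
  moreover have "0 \<notin> set (diag_mat S)"
    using S w_nz by (auto simp: diag_mat_def Sij)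
  ultimately have d: "det S \<noteq> 0"
    using det_upper_triangular[of S n] S by (simp add: prod_list_zero_iff)
  have "A * S = S * jordan_block n \<mu>"
  proof (rule eq_matI)
    fix i j assume "i < dim_row (S * jordan_block n \<mu>)" "j < dim_col (S * jordan_block n \<mu>)"
    hence ij: "i < n" "j < n" using S by auto
    have "(A * S) $$ (i,j) = (\<Sum>l<n. A $$ (i,l) * w (n - Suc j) l)"
      using ij by (subst mult_mat_index_sum[OF A S ij]) (auto simp: Sij)
    also have "\<dots> = (\<Sum>l<n. u i l * w (n - Suc j) l + (if l = i then \<mu> * w (n - Suc j) i else 0))"
      by (intro sum.cong) (auto simp: u_def algebra_simps)
    also have "\<dots> = w (n - j) i + \<mu> * w (n - Suc j) i"
      using ij by (simp add: sum.distrib wS[symmetric] Suc_diff_Suc)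
    finally have l: "(A * S) $$ (i,j) = w (n - j) i + \<mu> * w (n - Suc j) i" .
    have "(S * jordan_block n \<mu>) $$ (i,j)
        = (\<Sum>l<n. w (n - Suc l) i * (if l = j then \<mu> else if Suc l = j then 1 else 0))"
      using ij by (subst mult_mat_index_sum[OF S jordan_block_carrier ij]) (auto simp: Sij)
    also have "\<dots> = (\<Sum>l<n. (if l = j then \<mu> * w (n - Suc j) i else 0) +
                        (if Suc l = j then w (n - Suc l) i else 0))"
      by (intro sum.cong) auto
    also have "\<dots> = \<mu> * w (n - Suc j) i + w (n - j) i"
    \<comment> \<open>Column 0 of the Jordan block has no superdiagonal entry; the matching term
      \<open>w n\<close> is zero because the chain ends after n vectors.\<close>
    proof (cases j)
      case 0
      thus ?thesis using ij w_zero[of i n] by (simp add: sum.distrib)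
    next
      case (Suc j')
      thus ?thesis using ij by (simp add: sum.distrib)
    qed
    finally show "(A * S) $$ (i,j) = (S * jordan_block n \<mu>) $$ (i,j)" using l by simp
  qed (use A S in auto)
  from similar_mat_if_intertwined[OF A jordan_block_carrier S d this] show ?thesis .
qed

text \<open>If \<open>P = X + \<i>Y\<close> intertwines two real matrices, then so does \<open>X + tY\<close> for every real \<open>t\<close>, and
  \<open>det (X + tY)\<close> is a polynomial in \<open>t\<close> that does not vanish at \<open>\<i>\<close>.\<close>

lemma similar_mat_of_complex_similar:
  fixes A B :: "real mat"
  assumes A: "A \<in> carrier_mat n n" and B: "B \<in> carrier_mat n n"
    and sim: "similar_mat (map_mat complex_of_real A) (map_mat complex_of_real B)"
  shows "similar_mat A B"
proof -
  let ?c = "map_mat complex_of_real"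
  from sim obtain P Q where wit: "similar_mat_wit (?c A) (?c B) P Q" unfolding similar_mat_def by auto
  have cA: "?c A \<in> carrier_mat n n" and cB: "?c B \<in> carrier_mat n n" using A B by auto
  note w = similar_mat_witD2[OF cA wit]
  have P: "P \<in> carrier_mat n n" and Q: "Q \<in> carrier_mat n n" using w by auto
  have "?c A * P = P * ?c B * Q * P" by (rule arg_cong[OF w(3), of "\<lambda>M. M * P"])
  also have "\<dots> = P * ?c B * (Q * P)"
    by (rule assoc_mult_mat[OF mult_carrier_mat[OF P cB] Q P])
  finally have "?c A * P = P * ?c B * (Q * P)" .
  hence eq: "?c A * P = P * ?c B" using w(2) P cB by simp
  have detP: "det P \<noteq> 0" using w(1) det_mult[OF P Q] by auto
  define X where "X = (\<lambda>t. mat n n (\<lambda>(i,j). Re (P $$ (i,j)) + t * Im (P $$ (i,j))))"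
  have X: "X t \<in> carrier_mat n n" for t unfolding X_def by simp
  have inter: "A * X t = X t * B" for t
  proof (rule eq_matI)
    fix i j assume "i < dim_row (X t * B)" "j < dim_col (X t * B)"
    hence ij: "i < n" "j < n" using X[of t] B by auto
    have e: "(\<Sum>l<n. of_real (A $$ (i,l)) * P $$ (l,j)) = (\<Sum>l<n. P $$ (i,l) * of_real (B $$ (l,j)))"
      using arg_cong[OF eq, of "\<lambda>M. M $$ (i,j)"] ij A B
      by (simp add: mult_mat_index_sum[OF cA P ij] mult_mat_index_sum[OF P cB ij])
    have r: "(\<Sum>l<n. A $$ (i,l) * Re (P $$ (l,j))) = (\<Sum>l<n. Re (P $$ (i,l)) * B $$ (l,j))"
      using arg_cong[OF e, of Re] by simp
    have m: "(\<Sum>l<n. A $$ (i,l) * Im (P $$ (l,j))) = (\<Sum>l<n. Im (P $$ (i,l)) * B $$ (l,j))"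
      using arg_cong[OF e, of Im] by simp
    have "(A * X t) $$ (i,j) = (\<Sum>l<n. A $$ (i,l) * Re (P $$ (l,j))) + t * (\<Sum>l<n. A $$ (i,l) * Im (P $$ (l,j)))"
      using ij by (subst mult_mat_index_sum[OF A X ij])
        (auto simp: X_def algebra_simps sum.distrib sum_distrib_left)
    also have "\<dots> = (X t * B) $$ (i,j)" unfolding r m
      using ij by (subst mult_mat_index_sum[OF X B ij])
        (auto simp: X_def algebra_simps sum.distrib sum_distrib_left)
    finally show "(A * X t) $$ (i,j) = (X t * B) $$ (i,j)" .
  qed (use A B X[of t] in auto)
  define p :: "complex poly" where
    "p = det (mat n n (\<lambda>(i,j). [: of_real (Re (P $$ (i,j))), of_real (Im (P $$ (i,j))) :]))"
  have ev: "poly p z = det (mat n n (\<lambda>(i,j). of_real (Re (P $$ (i,j))) + z * of_real (Im (P $$ (i,j)))))" for z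
  proof -
    have "comm_ring_hom (\<lambda>q. poly q z)" by unfold_locales auto
    note h = comm_ring_hom.hom_det[OF this]
    show ?thesis unfolding p_def h[symmetric]
      by (rule arg_cong[of _ _ det], rule eq_matI) auto
  qed
  have "mat n n (\<lambda>(i,j). of_real (Re (P $$ (i,j))) + \<i> * of_real (Im (P $$ (i,j)))) = P"
    by (rule eq_matI) (use P in \<open>auto simp: complex_eq[symmetric]\<close>)
  hence "poly p \<i> \<noteq> 0" unfolding ev using detP by simp
  hence "p \<noteq> 0" by auto
  hence "finite {z. poly p z = 0}" by (rule poly_roots_finite)
  hence "finite (of_real -` {z. poly p z = 0} :: real set)"
    by (rule finite_vimageI) (rule inj_of_real)
  \<comment> \<open>Infinitely many reals against finitely many roots leave a real t with
    \<open>X t\<close> invertible.\<close>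
  then obtain t :: real where t: "t \<notin> of_real -` {z. poly p z = 0}"
    using ex_new_if_finite infinite_UNIV_char_0 by blast
  have "comm_ring_hom complex_of_real" by unfold_locales auto
  note r = comm_ring_hom.hom_det[OF this]
  have "poly p (of_real t) = det (?c (X t))" unfolding ev
    by (rule arg_cong[of _ _ det], rule eq_matI) (auto simp: X_def)
  also have "\<dots> = of_real (det (X t))" by (rule r)
  finally have "det (X t) \<noteq> 0" using t by auto
  from similar_mat_if_intertwined[OF A B X this inter] show ?thesis .
qed

text \<open>\<open>C\<close> is the real form of a conjugate pair of blocks. It acts as the Jordan
  block for a plus b times the quarter turn (x, y) to (-y, x). The quarter turn has the eigenvectors
  (v, -\<i> v) and (v, \<i> v) for \<i> and -\<i>; they form the columns of the transition matrix
  \<open>?S\<close>.\<close>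

lemma complexification_similar_conjugate_blocks:
  fixes a b :: real and k :: nat
  defines "C \<equiv> four_block_mat (jordan_block k a) ((-b) \<cdot>\<^sub>m 1\<^sub>m k) (b \<cdot>\<^sub>m 1\<^sub>m k) (jordan_block k a)"
  shows "similar_mat (map_mat complex_of_real C)
    (jordan_matrix [(k, Complex a b), (k, cnj (Complex a b))])"
proof -
  let ?l = "Complex a b"
  let ?X = "jordan_block k (complex_of_real a)" and ?I = "1\<^sub>m k :: complex mat"
  let ?J = "four_block_mat (jordan_block k ?l) (0\<^sub>m k k) (0\<^sub>m k k) (jordan_block k (cnj ?l))"
  let ?S = "four_block_mat ?I ?I ((-\<i>) \<cdot>\<^sub>m ?I) (\<i> \<cdot>\<^sub>m ?I)"
  let ?S' = "four_block_mat ((1/2) \<cdot>\<^sub>m ?I) ((\<i>/2) \<cdot>\<^sub>m ?I) ((1/2) \<cdot>\<^sub>m ?I) ((-\<i>/2) \<cdot>\<^sub>m ?I)"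
  let ?C = "four_block_mat ?X ((- of_real b) \<cdot>\<^sub>m ?I) (of_real b \<cdot>\<^sub>m ?I) ?X"
  have C: "map_mat complex_of_real C = ?C"
    unfolding C_def by (rule eq_matI) auto
  have J: "jordan_matrix [(k, ?l), (k, cnj ?l)] = ?J"
    unfolding jordan_matrix_def by (auto simp: Let_def)
  have SS': "?S * ?S' = 1\<^sub>m (k + k)"
    by (subst mult_four_block_mat[of _ k k _ k _ k _ _ k _ k], auto)
       (rule eq_matI, auto simp: algebra_simps)
  have S'S: "?S' * ?S = 1\<^sub>m (k + k)"
    by (rule mat_mult_left_right_inverse[OF _ _ SS']) auto
  have d: "det ?S \<noteq> 0"
    using arg_cong[OF SS', of det] det_mult[of ?S "k + k" ?S'] by auto
  have l: "?l = of_real a + \<i> * of_real b" by (simp add: complex_eq_iff)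
  have sl: "(c \<cdot>\<^sub>m ?I) * M = c \<cdot>\<^sub>m M" "M * (c \<cdot>\<^sub>m ?I) = c \<cdot>\<^sub>m M"
    if "M \<in> carrier_mat k k" for c and M :: "complex mat"
    using that mult_smult_assoc_mat[OF one_carrier_mat that, of c]
      mult_smult_distrib[OF that one_carrier_mat, of c] by auto
  have ss: "c \<cdot>\<^sub>m (d \<cdot>\<^sub>m M) = (c * d) \<cdot>\<^sub>m M" for c d and M :: "complex mat"
    by (rule eq_matI) auto
  have CS: "?C * ?S = four_block_mat
      (?X + (\<i> * of_real b) \<cdot>\<^sub>m ?I) (?X + (- \<i> * of_real b) \<cdot>\<^sub>m ?I)
      (of_real b \<cdot>\<^sub>m ?I + (-\<i>) \<cdot>\<^sub>m ?X) (of_real b \<cdot>\<^sub>m ?I + \<i> \<cdot>\<^sub>m ?X)"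
    by (subst mult_four_block_mat[of _ k k _ k _ k _ _ k _ k])
       (simp_all add: sl ss mult.commute)
  have SJ: "?S * ?J = four_block_mat (jordan_block k ?l) (jordan_block k (cnj ?l))
      ((-\<i>) \<cdot>\<^sub>m jordan_block k ?l) (\<i> \<cdot>\<^sub>m jordan_block k (cnj ?l))"
    by (subst mult_four_block_mat[of _ k k _ k _ k _ _ k _ k]) (simp_all add: sl)
  have "?C * ?S = ?S * ?J"
    unfolding CS SJ
    by (intro cong_four_block_mat; rule eq_matI) (auto simp: l algebra_simps)
  hence "similar_mat ?C ?J"
    by (intro similar_mat_if_intertwined[OF _ _ _ d]) auto
  thus ?thesis unfolding C J .
qed

subsection \<open>The matrix exponential\<close>

text \<open>\<open>mat_exp\<close> over an arbitrary complete normed field, so that it also applies to complex Jordan forms.\<close>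

definition mexp :: "'a :: {real_normed_field, banach} mat \<Rightarrow> 'a mat" where
  "mexp R = mat (dim_row R) (dim_col R) (\<lambda>(i,j). (\<Sum>k. (R ^\<^sub>m k) $$ (i,j) / fact k))"

lemma mat_exp_eq_mexp: "mat_exp R = mexp R"
  unfolding mat_exp_def mexp_def ..

lemma mexp_carrier [simp]: "A \<in> carrier_mat n m \<Longrightarrow> mexp A \<in> carrier_mat n m"
  unfolding mexp_def by auto

text \<open>An entry of a product is a sum of n products of entries, so each further factor R costs
  at most n times an entry bound. The geometric growth makes the exponential series converge
  absolutely.\<close>

lemma norm_pow_mat_entry_le:
  fixes R :: "'a :: real_normed_field mat"
  assumes R: "R \<in> carrier_mat n n"
  obtains c where "c \<ge> 0" "\<And>k i j. i < n \<Longrightarrow> j < n \<Longrightarrow> norm ((R ^\<^sub>m k) $$ (i,j)) \<le> c ^ k"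
proof -
  define b where "b = (\<Sum>i<n. \<Sum>j<n. norm (R $$ (i,j)))"
  have b0: "b \<ge> 0" unfolding b_def by (intro sum_nonneg) auto
  have b: "norm (R $$ (i,j)) \<le> b" if "i < n" "j < n" for i j
  proof -
    have "norm (R $$ (i,j)) \<le> (\<Sum>j<n. norm (R $$ (i,j)))"
      using that by (intro member_le_sum) auto
    also have "\<dots> \<le> b" unfolding b_def
      using that by (intro member_le_sum[of i "{..<n}" "\<lambda>i. \<Sum>j<n. norm (R $$ (i,j))"]) (auto intro: sum_nonneg)
    finally show ?thesis .
  qed
  have "norm ((R ^\<^sub>m k) $$ (i,j)) \<le> (n * b) ^ k" if "i < n" "j < n" for k i j
    using that
  proof (induction k arbitrary: i j)
    case 0
    thus ?case using R by auto
  next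
    case (Suc k)
    have "norm ((R ^\<^sub>m Suc k) $$ (i,j)) = norm (\<Sum>l<n. (R ^\<^sub>m k) $$ (i,l) * R $$ (l,j))"
      using mult_mat_index_sum[OF pow_carrier_mat[OF R] R Suc.prems] by simp
    also have "\<dots> \<le> (\<Sum>l<n. (n * b) ^ k * b)"
      by (intro sum_norm_le) (use Suc b b0 in \<open>auto simp: norm_mult intro!: mult_mono\<close>)
    also have "\<dots> = (n * b) ^ Suc k" by simp
    finally show ?case .
  qed
  thus thesis using that[of "n * b"] b0 by simp
qed

lemma mexp_sums:
  fixes R :: "'a :: {real_normed_field, banach} mat"
  assumes R: "R \<in> carrier_mat n n" and ij: "i < n" "j < n"
  shows "(\<lambda>k. (R ^\<^sub>m k) $$ (i,j) / fact k) sums (mexp R $$ (i,j))"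
proof -
  obtain c where c: "c \<ge> 0" "\<And>k i j. i < n \<Longrightarrow> j < n \<Longrightarrow> norm ((R ^\<^sub>m k) $$ (i,j)) \<le> c ^ k"
    using norm_pow_mat_entry_le[OF R] by blast
  have "summable (\<lambda>k. (R ^\<^sub>m k) $$ (i,j) / fact k)"
  proof (rule summable_comparison_test)
    show "summable (\<lambda>k. inverse (fact k) * c ^ k)" by (rule summable_exp)
    show "\<exists>N. \<forall>k\<ge>N. norm ((R ^\<^sub>m k) $$ (i,j) / fact k) \<le> inverse (fact k) * c ^ k"
      using c(2)[OF ij] by (auto simp: norm_divide field_simps intro!: divide_right_mono)
  qed
  thus ?thesis using R ij unfolding mexp_def by (auto dest: summable_sums)
qed

text \<open>Conjugation maps entries to finite linear combinations of entries, so it may be applied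
  to the series term by term. The witnesses are kept because \<open>mexp_similar_image\<close>
  conjugates a logarithm by them.\<close>

lemma mexp_similar_wit:
  assumes wit: "similar_mat_wit A B P Q"
  shows "similar_mat_wit (mexp A) (mexp B) P Q"
proof -
  define n where "n = dim_row A"
  note w = similar_mat_witD[OF n_def wit]
  have P: "P \<in> carrier_mat n n" and Q: "Q \<in> carrier_mat n n" and A: "A \<in> carrier_mat n n"
    and B: "B \<in> carrier_mat n n" using w by auto
  have entry: "(P * X * Q) $$ (i,j) = (\<Sum>m<n. (\<Sum>l<n. P $$ (i,l) * X $$ (l,m)) * Q $$ (m,j))"
    if "X \<in> carrier_mat n n" "i < n" "j < n" for X i j
    using that by (simp add: mult_mat_index_sum[OF mult_carrier_mat[OF P that(1)] Q]
        mult_mat_index_sum[OF P that(1)] del: index_mult_mat)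
  have "mexp A = P * mexp B * Q"
  proof (rule eq_matI)
    fix i j assume "i < dim_row (P * mexp B * Q)" "j < dim_col (P * mexp B * Q)"
    hence ij: "i < n" "j < n" using P Q by auto
    have "(\<lambda>k. \<Sum>m<n. (\<Sum>l<n. P $$ (i,l) * ((B ^\<^sub>m k) $$ (l,m) / fact k)) * Q $$ (m,j))
        sums (P * mexp B * Q) $$ (i,j)"
      unfolding entry[OF mexp_carrier[OF B] ij]
      by (intro sums_sum sums_mult2 sums_mult mexp_sums[OF B]) auto
    also have "(\<lambda>k. \<Sum>m<n. (\<Sum>l<n. P $$ (i,l) * ((B ^\<^sub>m k) $$ (l,m) / fact k)) * Q $$ (m,j))
        = (\<lambda>k. (A ^\<^sub>m k) $$ (i,j) / fact k)"
      unfolding similar_mat_wit_pow_id[OF wit] entry[OF pow_carrier_mat[OF B] ij]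
      by (simp add: sum_divide_distrib sum_distrib_right)
    finally show "mexp A $$ (i,j) = (P * mexp B * Q) $$ (i,j)"
      using mexp_sums[OF A ij] sums_unique2 by blast
  qed (use P Q mexp_carrier[OF A] in auto)
  thus ?thesis by (intro similar_mat_witI[OF w(1,2)]) (use P Q A B in auto)
qed

lemma mexp_similar: "similar_mat A B \<Longrightarrow> similar_mat (mexp A) (mexp B)"
  using mexp_similar_wit unfolding similar_mat_def by blast

lemma mexp_four_block:
  assumes A: "A \<in> carrier_mat n n" and B: "B \<in> carrier_mat m m"
  shows "mexp (four_block_mat A (0\<^sub>m n m) (0\<^sub>m m n) B)
    = four_block_mat (mexp A) (0\<^sub>m n m) (0\<^sub>m m n) (mexp B)"
proof (rule eq_matI)
  fix i j assume "i < dim_row (four_block_mat (mexp A) (0\<^sub>m n m) (0\<^sub>m m n) (mexp B))"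
    "j < dim_col (four_block_mat (mexp A) (0\<^sub>m n m) (0\<^sub>m m n) (mexp B))"
  hence ij: "i < n + m" "j < n + m" using mexp_carrier[OF A] mexp_carrier[OF B] by auto
  have d: "dim_row (A ^\<^sub>m k) = n" "dim_col (A ^\<^sub>m k) = n"
    "dim_row (B ^\<^sub>m k) = m" "dim_col (B ^\<^sub>m k) = m" for k
    using A B pow_carrier_mat[OF A, of k] pow_carrier_mat[OF B, of k] by auto
  have "mexp (four_block_mat A (0\<^sub>m n m) (0\<^sub>m m n) B) $$ (i,j)
    = (\<Sum>k. four_block_mat (A ^\<^sub>m k) (0\<^sub>m n m) (0\<^sub>m m n) (B ^\<^sub>m k) $$ (i,j) / fact k)"
    using ij A B unfolding mexp_def pow_four_block_mat[OF A B, symmetric] by simp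
  also have "\<dots> = four_block_mat (mexp A) (0\<^sub>m n m) (0\<^sub>m m n) (mexp B) $$ (i,j)"
    using ij A B d by (auto simp: mexp_def)
  finally show "mexp (four_block_mat A (0\<^sub>m n m) (0\<^sub>m m n) B) $$ (i,j)
    = four_block_mat (mexp A) (0\<^sub>m n m) (0\<^sub>m m n) (mexp B) $$ (i,j)" .
qed (use A B in \<open>auto simp: mexp_def\<close>)

lemma mexp_of_real:
  assumes L: "L \<in> carrier_mat n n"
  shows "mexp (map_mat complex_of_real L) = map_mat complex_of_real (mexp L)"
proof (rule eq_matI)
  fix i j assume "i < dim_row (map_mat complex_of_real (mexp L))"
    "j < dim_col (map_mat complex_of_real (mexp L))"
  hence ij: "i < n" "j < n" using mexp_carrier[OF L] by auto
  have cL: "map_mat complex_of_real L \<in> carrier_mat n n" using L by auto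
  have "(\<lambda>k. complex_of_real ((L ^\<^sub>m k) $$ (i,j) / fact k)) sums complex_of_real (mexp L $$ (i,j))"
    using mexp_sums[OF L ij] by (rule sums_of_real)
  also have "(\<lambda>k. complex_of_real ((L ^\<^sub>m k) $$ (i,j) / fact k))
      = (\<lambda>k. (map_mat complex_of_real L ^\<^sub>m k) $$ (i,j) / fact k)"
    using ij L by (intro ext) (auto simp: of_real_hom.mat_hom_pow[OF L, symmetric])
  finally show "mexp (map_mat complex_of_real L) $$ (i,j) = map_mat complex_of_real (mexp L) $$ (i,j)"
    using sums_unique2[OF mexp_sums[OF cL ij]] ij mexp_carrier[OF L] by auto
qed (use L in \<open>auto simp: mexp_def\<close>)

text \<open>Exponentiation does not split a block: the entries next to the diagonal are the
  derivative of exp at a, that is \<open>exp a\<close>, which never vanishes.\<close>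

lemma mexp_jordan_block:
  fixes a :: "'a :: {real_normed_field, banach}"
  shows "similar_mat (mexp (jordan_block n a)) (jordan_block n (exp a))"
proof (rule similar_jordan_block_if_superdiagonal_nonzero)
  let ?J = "jordan_block n a"
  have J: "?J \<in> carrier_mat n n" by simp
  show "mexp ?J \<in> carrier_mat n n" by simp
  note entry = sums_unique2[OF mexp_sums[OF J]]
  have e: "(\<lambda>k. a ^ k / fact k) sums exp a"
    using exp_converges[of a] by (simp add: scaleR_conv_of_real field_simps)
  show "mexp ?J $$ (i,j) = 0" if "j < i" "i < n" for i j
    using that by (intro entry) (auto simp: jordan_block_pow)
  show "mexp ?J $$ (i,i) = exp a" if "i < n" for i
    using that e by (intro entry) (auto simp: jordan_block_pow)
  \<comment> \<open>Cancelling k against the factorial turns the superdiagonal series into the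
    exponential series shifted by one index.\<close>
  have "(\<lambda>k. of_nat (Suc k) * a ^ k / fact (Suc k)) = (\<lambda>k. a ^ k / fact k)"
    by (simp add: fact_Suc field_simps del: of_nat_Suc)
  hence "(\<lambda>k. of_nat k * a ^ (k - 1) / fact k) sums exp a"
    using e sums_Suc_iff[of "\<lambda>k. of_nat k * a ^ (k - 1) / fact k" "exp a"] by simp
  hence "mexp ?J $$ (i, Suc i) = exp a" if "Suc i < n" for i
    using that by (intro entry) (auto simp: jordan_block_pow)
  thus "mexp ?J $$ (i, Suc i) \<noteq> 0" if "Suc i < n" for i using that by simp
qed

lemma mexp_jordan_matrix:
  fixes bs :: "(nat \<times> 'a :: {real_normed_field, banach}) list"
  shows "similar_mat (mexp (jordan_matrix bs)) (jordan_matrix (map (apsnd exp) bs))"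
proof (induction bs)
  case Nil
  have "mexp (jordan_matrix []) = (jordan_matrix [] :: 'a mat)"
    by (rule eq_matI) (auto simp: mexp_def jordan_matrix_def)
  thus ?case using similar_mat_refl[OF jordan_matrix_carrier] by simp
next
  case (Cons b bs)
  obtain k a where b: "b = (k,a)" by force
  have s: "sum_list (map fst (map (apsnd exp) bs)) = sum_list (map fst bs)"
    by (induction bs) auto
  show ?case unfolding b list.map apsnd_conv jordan_matrix_Cons s
    by (subst mexp_four_block, simp, simp)
       (rule similar_mat_four_block_0_0[OF mexp_jordan_block Cons.IH], auto)
qed

lemma jordan_nf_mexp:
  fixes A :: "'a :: {real_normed_field, banach} mat"
  assumes "jordan_nf A bs"
  shows "jordan_nf (mexp A) (map (apsnd exp) bs)"
proof -
  have "similar_mat (mexp A) (mexp (jordan_matrix bs))"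
    using assms mexp_similar unfolding jordan_nf_def by auto
  from similar_mat_trans[OF this mexp_jordan_matrix] show ?thesis
    using assms unfolding jordan_nf_def by force
qed

subsection \<open>Linear differential equations\<close>

text \<open>The oriented integral from 0 to t: the integral over an empty interval is 0, so the
  first term serves positive t and the second one negative t.\<close>

definition antideriv :: "(real \<Rightarrow> real) \<Rightarrow> real \<Rightarrow> real" where
  "antideriv f t = integral {0..t} f - integral {t..0} f"

lemma antideriv_0 [simp]: "antideriv f 0 = 0"
  by (simp add: antideriv_def)

lemma antideriv_has_real_derivative:
  assumes "continuous_on UNIV f"
  shows "(antideriv f has_real_derivative f t) (at t)"
proof -
  \<comment> \<open>An interval with 0 and t in its interior. On it the oriented integral differs by
    a constant from the integral with fixed left endpoint a, to which the fundamental theorem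
    applies.\<close>
  define a b where "a = - \<bar>t\<bar> - 1" and "b = \<bar>t\<bar> + 1"
  have cont: "continuous_on S f" for S using assms continuous_on_subset by blast
  have eq: "antideriv f s = integral {a..s} f - integral {a..0} f" if "s \<in> {a<..<b}" for s
  proof (cases "s \<ge> 0")
    case True
    have "integral {a..0} f + integral {0..s} f = integral {a..s} f"
      by (rule Henstock_Kurzweil_Integration.integral_combine)
        (use True in \<open>auto simp: a_def intro!: integrable_continuous_real cont\<close>)
    moreover have "integral {s..0} f = 0" using True by (cases "s = 0") auto
    ultimately show ?thesis by (simp add: antideriv_def)
  next
    case False
    have "integral {a..s} f + integral {s..0} f = integral {a..0} f"
      by (rule Henstock_Kurzweil_Integration.integral_combine)
        (use False that in \<open>auto simp: a_def intro!: integrable_continuous_real cont\<close>)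
    thus ?thesis using False by (simp add: antideriv_def)
  qed
  have t: "t \<in> {a<..<b}" by (auto simp: a_def b_def)
  have "((\<lambda>s. integral {a..s} f) has_real_derivative f t) (at t within {a..b})"
    using t by (intro integral_has_real_derivative cont) auto
  hence "((\<lambda>s. integral {a..s} f) has_real_derivative f t) (at t)"
    using t by (simp add: at_within_Icc_at)
  hence "((\<lambda>s. integral {a..s} f - integral {a..0} f) has_real_derivative f t) (at t)"
    by (auto intro!: derivative_eq_intros)
  thus ?thesis
    by (rule has_field_derivative_transform_within_open[of _ _ _ "{a<..<b}"]) (use t eq in auto)
qed

text \<open>One integration step in the estimate of the Peano-Baker terms. For t >= 0 the difference
  between the bound and F, and likewise -F, is monotone; negative t is reduced to this by
  reflection.\<close>

lemma abs_le_if_abs_derivative_le_power: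
  fixes F f :: "real \<Rightarrow> real"
  assumes F: "\<And>s. (F has_real_derivative f s) (at s)" and F0: "F 0 = 0"
    and f: "\<And>s. \<bar>s\<bar> \<le> \<bar>t\<bar> \<Longrightarrow> \<bar>f s\<bar> \<le> C * \<bar>s\<bar> ^ k"
  shows "\<bar>F t\<bar> \<le> C * \<bar>t\<bar> ^ Suc k / real (Suc k)"
proof -
  have pos: "\<bar>G u\<bar> \<le> C * u ^ Suc k / real (Suc k)"
    if G: "\<And>s. (G has_real_derivative g s) (at s)" and G0: "G 0 = 0" and u: "u \<ge> 0"
      and g: "\<And>s. 0 \<le> s \<Longrightarrow> s \<le> u \<Longrightarrow> \<bar>g s\<bar> \<le> C * s ^ k" for G g :: "real \<Rightarrow> real" and u
  proof -
    have up: "H u \<le> C * u ^ Suc k / real (Suc k)"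
      if H: "\<And>s. (H has_real_derivative h s) (at s)" and H0: "H 0 = 0"
      and h: "\<And>s. 0 \<le> s \<Longrightarrow> s \<le> u \<Longrightarrow> h s \<le> C * s ^ k" for H h :: "real \<Rightarrow> real"
    proof -
      have "(\<lambda>s. C * s ^ Suc k / real (Suc k) - H s) 0 \<le> (\<lambda>s. C * s ^ Suc k / real (Suc k) - H s) u"
      proof (rule DERIV_nonneg_imp_nondecreasing[OF u])
        fix s assume s: "0 \<le> s" "s \<le> u"
        have "((\<lambda>s. C * s ^ Suc k / real (Suc k) - H s) has_real_derivative
            C * (real (Suc k) * s ^ k) / real (Suc k) - h s) (at s)"
          by (rule derivative_eq_intros H refl | simp)+
        moreover have "C * (real (Suc k) * s ^ k) / real (Suc k) - h s \<ge> 0"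
          using h[OF s] by simp
        ultimately show "\<exists>y. ((\<lambda>s. C * s ^ Suc k / real (Suc k) - H s) has_real_derivative y) (at s) \<and> 0 \<le> y"
          by blast
      qed
      thus ?thesis using H0 by simp
    qed
    have "G u \<le> C * u ^ Suc k / real (Suc k)"
      using g by (intro up[OF G G0]) (auto intro: abs_le_D1)
    moreover have "- G u \<le> C * u ^ Suc k / real (Suc k)"
    proof (rule up)
      show "((\<lambda>s. - G s) has_real_derivative - g s) (at s)" for s
        using G by (auto intro!: derivative_eq_intros)
    qed (use g G0 in \<open>auto intro: abs_le_D2\<close>)
    ultimately show ?thesis by linarith
  qed
  show ?thesis
  proof (cases "t \<ge> 0")
    case True
    have "\<bar>F t\<bar> \<le> C * t ^ Suc k / real (Suc k)"
    proof (rule pos[OF F F0 True])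
      show "\<bar>f s\<bar> \<le> C * s ^ k" if "0 \<le> s" "s \<le> t" for s
        using f[of s] that by simp
    qed
    thus ?thesis using True by simp
  next
    case False
    have "\<bar>(\<lambda>s. F (- s)) (- t)\<bar> \<le> C * (- t) ^ Suc k / real (Suc k)"
    proof (rule pos)
      show "((\<lambda>s. F (- s)) has_real_derivative - f (- s)) (at s)" for s
        using DERIV_mirror[of F "f (- s)" s] F by simp
      show "\<bar>- f (- s)\<bar> \<le> C * s ^ k" if "0 \<le> s" "s \<le> - t" for s
        using f[of "- s"] that False by simp
    qed (use F0 False in auto)
    thus ?thesis using False by simp
  qed
qed

text \<open>The increments of Picard iteration: term k + 1 is a primitive of A times term k, so the
  sum formally solves X' = A X. Integrating from 0 makes every term but the first vanish at 0, so
  the sum starts at the identity.\<close>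

primrec peano_baker :: "nat \<Rightarrow> (real \<Rightarrow> real mat) \<Rightarrow> nat \<Rightarrow> real \<Rightarrow> real mat" where
  "peano_baker n A 0 = (\<lambda>t. 1\<^sub>m n)"
| "peano_baker n A (Suc k) =
     (\<lambda>t. mat n n (\<lambda>(i,j). antideriv (\<lambda>s. (A s * peano_baker n A k s) $$ (i,j)) t))"

text \<open>Invertibility is left out here, so that uniqueness can be stated for arbitrary initial
  values and invertibility derived from it.\<close>

definition matrix_solution :: "nat \<Rightarrow> (real \<Rightarrow> real mat) \<Rightarrow> (real \<Rightarrow> real mat) \<Rightarrow> bool" where
  "matrix_solution n A \<Phi> \<longleftrightarrow> (\<forall>t. \<Phi> t \<in> carrier_mat n n) \<and>
     (\<forall>t i j. i < n \<longrightarrow> j < n \<longrightarrow>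
        ((\<lambda>s. \<Phi> s $$ (i,j)) has_real_derivative (A t * \<Phi> t) $$ (i,j)) (at t))"

lemma matrix_solution_shift:
  assumes Y: "matrix_solution n A Y" and A: "\<And>t. A (t + T) = A t"
  shows "matrix_solution n A (\<lambda>t. Y (t + T))"
proof -
  have "((\<lambda>s. Y (s + T) $$ (i,j)) has_real_derivative (A t * Y (t + T)) $$ (i,j)) (at t)"
    if "i < n" "j < n" for i j t
    using Y that DERIV_shift[of "\<lambda>s. Y s $$ (i,j)" "(A (t + T) * Y (t + T)) $$ (i,j)" t T] A[of t]
    unfolding matrix_solution_def by metis
  thus ?thesis using Y unfolding matrix_solution_def by simp
qed

lemma peano_baker_carrier [simp]: "peano_baker n A k t \<in> carrier_mat n n"
  by (cases k) auto

section \<open>Existence of solutions by the Peano-Baker series\<close>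

context
  fixes n :: nat and A :: "real \<Rightarrow> real mat"
  assumes A: "\<And>t. A t \<in> carrier_mat n n"
    and cont: "\<And>i j. i < n \<Longrightarrow> j < n \<Longrightarrow> continuous_on UNIV (\<lambda>t. A t $$ (i,j))"
begin

lemma mult_continuous:
  assumes "\<And>t. U t \<in> carrier_mat n n"
    and "\<And>i j. i < n \<Longrightarrow> j < n \<Longrightarrow> continuous_on UNIV (\<lambda>t. U t $$ (i,j))"
    and "i < n" "j < n"
  shows "continuous_on UNIV (\<lambda>t. (A t * U t) $$ (i,j))"
  using assms by (simp only: mult_mat_index_sum[OF A assms(1) assms(3,4)])
    (intro continuous_intros cont, auto)

lemma peano_baker_continuous:
  assumes "i < n" "j < n"
  shows "continuous_on UNIV (\<lambda>t. peano_baker n A k t $$ (i,j))"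
  using assms
proof (induction k arbitrary: i j)
  case (Suc k)
  have "continuous_on UNIV (antideriv (\<lambda>s. (A s * peano_baker n A k s) $$ (i,j)))"
    by (intro continuous_at_imp_continuous_on ballI DERIV_isCont[OF antideriv_has_real_derivative]
        mult_continuous peano_baker_carrier Suc)
  thus ?case using Suc.prems by simp
qed simp

lemma peano_baker_derivative:
  assumes "i < n" "j < n"
  shows "((\<lambda>s. peano_baker n A (Suc k) s $$ (i,j)) has_real_derivative
    (A t * peano_baker n A k t) $$ (i,j)) (at t)"
  using antideriv_has_real_derivative[OF mult_continuous[OF peano_baker_carrier peano_baker_continuous assms]]
    assms by simp

lemma entries_bounded:
  obtains a where "a \<ge> 0" "\<And>i j s. i < n \<Longrightarrow> j < n \<Longrightarrow> \<bar>s\<bar> \<le> r \<Longrightarrow> \<bar>A s $$ (i,j)\<bar> \<le> a"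
proof -
  have "\<exists>b. \<forall>s\<in>{-r..r}. \<bar>A s $$ (i,j)\<bar> \<le> b" if "i < n" "j < n" for i j
  proof -
    have "compact ((\<lambda>s. A s $$ (i,j)) ` {-r..r})"
      using cont[OF that] by (intro compact_continuous_image) (auto intro: continuous_on_subset)
    from compact_imp_bounded[OF this] show ?thesis
      unfolding bounded_iff by auto
  qed
  then obtain b where b: "\<And>i j s. i < n \<Longrightarrow> j < n \<Longrightarrow> \<bar>s\<bar> \<le> r \<Longrightarrow> \<bar>A s $$ (i,j)\<bar> \<le> b i j"
    by (metis abs_le_iff atLeastAtMost_iff minus_le_iff)
  define a where "a = (\<Sum>i<n. \<Sum>j<n. \<bar>b i j\<bar>)"
  have "\<bar>A s $$ (i,j)\<bar> \<le> a" if "i < n" "j < n" "\<bar>s\<bar> \<le> r" for i j s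
  proof -
    have "\<bar>A s $$ (i,j)\<bar> \<le> \<bar>b i j\<bar>" using b[OF that] by linarith
    also have "\<dots> \<le> (\<Sum>j<n. \<bar>b i j\<bar>)"
      using that by (intro member_le_sum) auto
    also have "\<dots> \<le> a" unfolding a_def
      using that by (intro member_le_sum[of i "{..<n}" "\<lambda>i. \<Sum>j<n. \<bar>b i j\<bar>"]) (auto intro: sum_nonneg)
    finally show ?thesis .
  qed
  moreover have "a \<ge> 0" unfolding a_def by (intro sum_nonneg) auto
  ultimately show thesis using that by blast
qed

context
  fixes a r :: real
  assumes a: "\<And>i j s. i < n \<Longrightarrow> j < n \<Longrightarrow> \<bar>s\<bar> \<le> r \<Longrightarrow> \<bar>A s $$ (i,j)\<bar> \<le> a"
    and a0: "a \<ge> 0"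
begin

lemma mult_entry_bound:
  assumes U: "U \<in> carrier_mat n n" "\<And>i j. i < n \<Longrightarrow> j < n \<Longrightarrow> \<bar>U $$ (i,j)\<bar> \<le> c"
    and ij: "i < n" "j < n" and t: "\<bar>t\<bar> \<le> r"
  shows "\<bar>(A t * U) $$ (i,j)\<bar> \<le> n * a * c"
proof -
  have "\<bar>(A t * U) $$ (i,j)\<bar> \<le> (\<Sum>l<n. \<bar>A t $$ (i,l) * U $$ (l,j)\<bar>)"
    unfolding mult_mat_index_sum[OF A U(1) ij] by (rule sum_abs)
  also have "\<dots> \<le> (\<Sum>l<n. a * c)"
    unfolding abs_mult by (intro sum_mono mult_mono a U) (use ij t a0 in auto)
  finally show ?thesis by simp
qed

text \<open>Each step multiplies by at most n a and integrates a k-th power, which supplies the next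
  factor of the factorial. The bounds are the terms of an exponential series.\<close>

lemma peano_baker_bound:
  assumes "i < n" "j < n" "\<bar>t\<bar> \<le> r"
  shows "\<bar>peano_baker n A k t $$ (i,j)\<bar> \<le> (n * a) ^ k / fact k * \<bar>t\<bar> ^ k"
  using assms
proof (induction k arbitrary: i j t)
  case (Suc k)
  have "\<bar>peano_baker n A (Suc k) t $$ (i,j)\<bar>
      \<le> (n * a * ((n * a) ^ k / fact k)) * \<bar>t\<bar> ^ Suc k / real (Suc k)"
  proof (rule abs_le_if_abs_derivative_le_power[OF peano_baker_derivative])
    fix s assume "\<bar>s\<bar> \<le> \<bar>t\<bar>"
    hence s: "\<bar>s\<bar> \<le> r" using Suc.prems by simp
    have "\<bar>(A s * peano_baker n A k s) $$ (i,j)\<bar> \<le> n * a * ((n * a) ^ k / fact k * \<bar>s\<bar> ^ k)"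
      by (rule mult_entry_bound[OF peano_baker_carrier Suc.IH]) (use Suc.prems s in auto)
    thus "\<bar>(A s * peano_baker n A k s) $$ (i,j)\<bar> \<le> n * a * ((n * a) ^ k / fact k) * \<bar>s\<bar> ^ k"
      by (simp only: mult.assoc)
  qed (use Suc.prems in auto)
  also have "\<dots> = (n * a) ^ Suc k / fact (Suc k) * \<bar>t\<bar> ^ Suc k"
    by (simp add: fact_Suc field_simps del: of_nat_Suc)
  finally show ?case .
qed simp

end

text \<open>On a bounded interval the differentiated series is dominated by an exponential series,
  so the Weierstrass test permits differentiation term by term.\<close>

lemma matrix_solution_exists: "\<exists>\<Phi>. matrix_solution n A \<Phi> \<and> \<Phi> 0 = 1\<^sub>m n"
proof -
  define \<Phi> where "\<Phi> = (\<lambda>t. mat n n (\<lambda>(i,j). \<Sum>k. peano_baker n A k t $$ (i,j)))"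
  have \<Phi>: "\<Phi> t \<in> carrier_mat n n" for t unfolding \<Phi>_def by simp
  have series: "summable (\<lambda>k. peano_baker n A k t $$ (i,j))"
    "((\<lambda>s. \<Sum>k. peano_baker n A k s $$ (i,j)) has_real_derivative
       (\<Sum>k. (A t * peano_baker n A k t) $$ (i,j))) (at t)"
    "summable (\<lambda>k. (A t * peano_baker n A k t) $$ (i,j))"
    if ij: "i < n" "j < n" for i j t
  proof -
    \<comment> \<open>The extra 1 puts t in the interior of the interval, as two-sided
      differentiability at t requires.\<close>
    define r where "r = \<bar>t\<bar> + 1"
    have r: "r \<ge> 0" "\<bar>t\<bar> < r" unfolding r_def by auto
    obtain a where a0: "a \<ge> 0"
      and a: "\<And>i j s. i < n \<Longrightarrow> j < n \<Longrightarrow> \<bar>s\<bar> \<le> r \<Longrightarrow> \<bar>A s $$ (i,j)\<bar> \<le> a"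
      using entries_bounded[of r] by blast
    \<comment> \<open>Term 0 is constant and term k + 1 has derivative A times term k; hence the
      index shift and the value 0 at the start, both in the derivatives and in their bounds
      \<open>M\<close>.\<close>
    define f' where "f' = (\<lambda>k s. case k of 0 \<Rightarrow> 0 | Suc k \<Rightarrow> (A s * peano_baker n A k s) $$ (i,j))"
    define M where "M = (\<lambda>k. case k of 0 \<Rightarrow> 0 | Suc k \<Rightarrow> n * a * (inverse (fact k) * (n * a * r) ^ k))"
    have "summable (\<lambda>k. M (Suc k))" unfolding M_def nat.case
      by (intro summable_mult summable_exp)
    hence sM: "summable M" by (subst (asm) summable_Suc_iff)
    have le: "norm (f' k s) \<le> M k" if "s \<in> {-r..r}" for k s
    proof (cases k)
      case (Suc l)
      have s: "\<bar>s\<bar> \<le> r" using that by auto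
      have "norm (f' k s) \<le> n * a * ((n * a) ^ l / fact l * \<bar>s\<bar> ^ l)"
        unfolding f'_def Suc nat.case real_norm_def
        by (rule mult_entry_bound[OF a a0 peano_baker_carrier peano_baker_bound[OF a a0]]) (use ij s in auto)
      also have "\<dots> \<le> n * a * ((n * a) ^ l / fact l * r ^ l)"
        using s a0 by (intro mult_left_mono power_mono) auto
      also have "\<dots> = M k" unfolding M_def Suc by (simp add: power_mult_distrib field_simps)
      finally show ?thesis .
    qed (simp add: f'_def M_def)
    have unif: "uniformly_convergent_on {-r..r} (\<lambda>m s. \<Sum>k<m. f' k s)"
      by (rule Weierstrass_m_test'[OF le sM])
    have der: "((\<lambda>s. peano_baker n A k s $$ (i,j)) has_real_derivative f' k s) (at s within {-r..r})" for k s
    proof (cases k)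
      case 0
      thus ?thesis by (simp add: f'_def)
    next
      case (Suc l)
      show ?thesis using peano_baker_derivative[OF ij, of l s] unfolding Suc f'_def nat.case
        by (rule has_field_derivative_at_within)
    qed
    \<comment> \<open>Termwise differentiation also needs convergence at one point; at 0 only the
      first term survives.\<close>
    have "peano_baker n A k 0 $$ (i,j) = 0" if "k \<noteq> 0" for k
      using that ij by (cases k) auto
    hence s0: "summable (\<lambda>k. peano_baker n A k 0 $$ (i,j))"
      by (intro summable_finite[of "{0}"]) auto
    have t: "t \<in> interior {-r..r}" using r by (auto simp: interior_atLeastAtMost_real)
    note res = has_field_derivative_series'[OF convex_real_interval(5) der unif _ s0 t]
    show "summable (\<lambda>k. peano_baker n A k t $$ (i,j))" using res(1) r by auto
    have "summable (\<lambda>k. f' k t)"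
      using r by (intro summable_comparison_test'[OF sM, of 0] le) auto
    hence *: "summable (\<lambda>k. f' (Suc k) t)" by (subst summable_Suc_iff)
    thus "summable (\<lambda>k. (A t * peano_baker n A k t) $$ (i,j))" by (simp add: f'_def)
    have "(\<Sum>k. f' k t) = (\<Sum>k. f' (Suc k) t) + f' 0 t"
      using suminf_split_head[of "\<lambda>k. f' k t"] \<open>summable (\<lambda>k. f' k t)\<close> by simp
    hence "(\<Sum>k. f' k t) = (\<Sum>k. (A t * peano_baker n A k t) $$ (i,j))" by (simp add: f'_def)
    thus "((\<lambda>s. \<Sum>k. peano_baker n A k s $$ (i,j)) has_real_derivative
       (\<Sum>k. (A t * peano_baker n A k t) $$ (i,j))) (at t)"
      using res(2) r by auto
  qed
  have "((\<lambda>s. \<Phi> s $$ (i,j)) has_real_derivative (A t * \<Phi> t) $$ (i,j)) (at t)"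
    if ij: "i < n" "j < n" for i j t
  proof -
    have "(\<Sum>k. (A t * peano_baker n A k t) $$ (i,j))
        = (\<Sum>k. \<Sum>l<n. A t $$ (i,l) * peano_baker n A k t $$ (l,j))"
      by (simp only: mult_mat_index_sum[OF A peano_baker_carrier ij])
    also have "\<dots> = (\<Sum>l<n. \<Sum>k. A t $$ (i,l) * peano_baker n A k t $$ (l,j))"
      by (rule suminf_sum) (use series(1) ij in \<open>auto intro!: summable_mult\<close>)
    also have "\<dots> = (\<Sum>l<n. A t $$ (i,l) * \<Phi> t $$ (l,j))"
      using ij by (intro sum.cong refl) (auto simp: \<Phi>_def suminf_mult series(1))
    also have "\<dots> = (A t * \<Phi> t) $$ (i,j)" by (rule mult_mat_index_sum[OF A \<Phi> ij, symmetric])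
    finally show ?thesis using series(2)[OF ij, of t] ij by (simp add: \<Phi>_def)
  qed
  moreover have "\<Phi> 0 = 1\<^sub>m n"
  proof (rule eq_matI)
    fix i j assume "i < dim_row (1\<^sub>m n :: real mat)" "j < dim_col (1\<^sub>m n :: real mat)"
    hence ij: "i < n" "j < n" by auto
    have "peano_baker n A k 0 $$ (i,j) = 0" if "k \<notin> {0}" for k
      using that ij by (cases k) auto
    from suminf_finite[of "{0}", OF _ this]
    show "\<Phi> 0 $$ (i,j) = 1\<^sub>m n $$ (i,j)" using ij by (simp add: \<Phi>_def)
  qed (auto simp: \<Phi>_def)
  ultimately show ?thesis using \<Phi> unfolding matrix_solution_def by blast
qed

end

text \<open>A solution \<open>\<Psi>\<close> of the adjoint equation \<open>\<Psi>' = - \<Psi> A\<close> makes \<open>\<Psi> Y\<close> constant for every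
  solution \<open>Y\<close>; this gives both invertibility of the propagator and uniqueness.\<close>

lemma propagator_exists:
  assumes A: "\<And>t. A t \<in> carrier_mat n n"
    and cont: "\<And>i j. i < n \<Longrightarrow> j < n \<Longrightarrow> continuous_on UNIV (\<lambda>t. A t $$ (i,j))"
  obtains \<Phi> \<Psi> where "matrix_solution n A \<Phi>" "\<Phi> 0 = 1\<^sub>m n"
    "\<And>t. \<Psi> t \<in> carrier_mat n n" "\<And>t. \<Phi> t * \<Psi> t = 1\<^sub>m n" "\<And>t. \<Psi> t * \<Phi> t = 1\<^sub>m n"
    "\<And>Y t. matrix_solution n A Y \<Longrightarrow> Y t = \<Phi> t * Y 0"
proof -
  obtain \<Phi> where \<Phi>: "matrix_solution n A \<Phi>" "\<Phi> 0 = 1\<^sub>m n"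
    using matrix_solution_exists[OF A cont] by blast
  \<comment> \<open>B is minus the transpose of A: transposing X' = B X gives the adjoint equation,
    so existence need not be proved again.\<close>
  define B where "B = (\<lambda>t. mat n n (\<lambda>(i,j). - A t $$ (j,i)))"
  have B: "B t \<in> carrier_mat n n" for t unfolding B_def by simp
  have "continuous_on UNIV (\<lambda>t. B t $$ (i,j))" if "i < n" "j < n" for i j
    using that cont by (auto simp: B_def intro!: continuous_intros)
  from matrix_solution_exists[OF B this]
  obtain X where X: "matrix_solution n B X" "X 0 = 1\<^sub>m n" by blast
  define \<Psi> where "\<Psi> = (\<lambda>t. transpose_mat (X t))"
  have Xc: "X t \<in> carrier_mat n n" for t using X unfolding matrix_solution_def by auto
  have \<Psi>: "\<Psi> t \<in> carrier_mat n n" for t using Xc[of t] unfolding \<Psi>_def by auto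
  have \<Psi>0: "\<Psi> 0 = 1\<^sub>m n" unfolding \<Psi>_def X by simp
  have \<Psi>': "((\<lambda>s. \<Psi> s $$ (i,j)) has_real_derivative - (\<Psi> t * A t) $$ (i,j)) (at t)"
    if ij: "i < n" "j < n" for i j t
  proof -
    have "((\<lambda>s. X s $$ (j,i)) has_real_derivative (B t * X t) $$ (j,i)) (at t)"
      using X ij unfolding matrix_solution_def by auto
    also have "(\<lambda>s. X s $$ (j,i)) = (\<lambda>s. \<Psi> s $$ (i,j))"
      using ij carrier_matD[OF Xc] unfolding \<Psi>_def by (intro ext, subst index_transpose_mat) auto
    also have "(B t * X t) $$ (j,i) = (\<Sum>l<n. - (\<Psi> t $$ (i,l) * A t $$ (l,j)))"
      using ij Xc[of t] by (subst mult_mat_index_sum[OF B Xc]) (auto simp: B_def \<Psi>_def intro!: sum.cong)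
    also have "\<dots> = - (\<Psi> t * A t) $$ (i,j)"
      by (simp add: mult_mat_index_sum[OF \<Psi> A ij] sum_negf del: index_mult_mat)
    finally show ?thesis .
  qed
  have const: "\<Psi> t * Y t = Y 0" if Y: "matrix_solution n A Y" for Y t
  proof -
    have Yc: "Y t \<in> carrier_mat n n" for t using Y unfolding matrix_solution_def by auto
    have "\<Psi> t * Y t = \<Psi> 0 * Y 0"
    proof (rule eq_matI)
      fix i j assume "i < dim_row (\<Psi> 0 * Y 0)" "j < dim_col (\<Psi> 0 * Y 0)"
      hence ij: "i < n" "j < n" using \<Psi>[of 0] Yc[of 0] by auto
      have "((\<lambda>s. (\<Psi> s * Y s) $$ (i,j)) has_real_derivative 0) (at s)" for s
      proof -
        \<comment> \<open>By the product rule the derivative is - \<Psi> A Y + \<Psi> A Y, which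
          cancels by associativity.\<close>
        have "((\<lambda>s. \<Sum>l<n. \<Psi> s $$ (i,l) * Y s $$ (l,j)) has_real_derivative
          (\<Sum>l<n. - (\<Psi> s * A s) $$ (i,l) * Y s $$ (l,j) + (A s * Y s) $$ (l,j) * \<Psi> s $$ (i,l))) (at s)"
          using Y ij unfolding matrix_solution_def by (intro DERIV_sum DERIV_mult \<Psi>') auto
        moreover have "(\<Sum>l<n. - (\<Psi> s * A s) $$ (i,l) * Y s $$ (l,j) + (A s * Y s) $$ (l,j) * \<Psi> s $$ (i,l))
            = - (\<Psi> s * A s * Y s) $$ (i,j) + (\<Psi> s * (A s * Y s)) $$ (i,j)"
          by (simp add: mult_mat_index_sum[OF mult_carrier_mat[OF \<Psi> A] Yc ij]
            mult_mat_index_sum[OF \<Psi> mult_carrier_mat[OF A Yc] ij] sum_subtractf mult.commute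
            del: index_mult_mat)
        moreover have "\<Psi> s * A s * Y s = \<Psi> s * (A s * Y s)"
          by (rule assoc_mult_mat[OF \<Psi> A Yc])
        ultimately show ?thesis by (simp only: mult_mat_index_sum[OF \<Psi> Yc ij]) simp
      qed
      thus "(\<Psi> t * Y t) $$ (i,j) = (\<Psi> 0 * Y 0) $$ (i,j)"
        using DERIV_isconst_all[of "\<lambda>s. (\<Psi> s * Y s) $$ (i,j)"] by blast
    qed (use \<Psi>[of t] \<Psi>[of 0] Yc[of t] Yc[of 0] in auto)
    thus ?thesis using \<Psi>0 Yc[of 0] by simp
  qed
  have \<Phi>c: "\<Phi> t \<in> carrier_mat n n" for t using \<Phi> unfolding matrix_solution_def by auto
  have inv1: "\<Psi> t * \<Phi> t = 1\<^sub>m n" for t using const[OF \<Phi>(1)] \<Phi>(2) by simp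
  have inv2: "\<Phi> t * \<Psi> t = 1\<^sub>m n" for t by (rule mat_mult_left_right_inverse[OF \<Psi> \<Phi>c inv1])
  have "Y t = \<Phi> t * Y 0" if Y: "matrix_solution n A Y" for Y t
  proof -
    have Yc: "Y t \<in> carrier_mat n n" using Y unfolding matrix_solution_def by auto
    have "\<Phi> t * Y 0 = \<Phi> t * (\<Psi> t * Y t)" unfolding const[OF Y] ..
    also have "\<dots> = \<Phi> t * \<Psi> t * Y t" by (rule assoc_mult_mat[OF \<Phi>c \<Psi> Yc, symmetric])
    also have "\<dots> = Y t" using inv2 Yc by simp
    finally show ?thesis ..
  qed
  from that[OF \<Phi> \<Psi> inv2 inv1 this] show thesis .
qed

section \<open>The exponential as solution of the autonomous system\<close>

lemma mat_exp_matrix_solution: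
  assumes R: "R \<in> carrier_mat n n"
  shows "matrix_solution n (\<lambda>_. R) (\<lambda>t. mat_exp (t \<cdot>\<^sub>m R))"
proof -
  have pow: "(t \<cdot>\<^sub>m R) ^\<^sub>m k = t ^ k \<cdot>\<^sub>m (R ^\<^sub>m k)" for t k
  proof (induction k)
    case 0
    show ?case using R by (intro eq_matI) auto
  next
    case (Suc k)
    have "(t \<cdot>\<^sub>m R) ^\<^sub>m Suc k = t \<cdot>\<^sub>m (t ^ k \<cdot>\<^sub>m (R ^\<^sub>m k) * R)"
      using R Suc by (simp add: mult_smult_distrib[OF smult_carrier_mat[OF pow_carrier_mat[OF R]] R])
    also have "t ^ k \<cdot>\<^sub>m (R ^\<^sub>m k) * R = t ^ k \<cdot>\<^sub>m (R ^\<^sub>m k * R)"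
      by (rule mult_smult_assoc_mat[OF pow_carrier_mat[OF R] R])
    finally show ?case by (auto intro!: eq_matI)
  qed
  have E: "mat_exp (t \<cdot>\<^sub>m R) \<in> carrier_mat n n" for t
    using R by (simp add: mat_exp_eq_mexp)
  \<comment> \<open>Each entry is read as a power series in t that converges everywhere, so it may
    be differentiated termwise.\<close>
  have sums: "(\<lambda>k. (R ^\<^sub>m k) $$ (i,j) / fact k * t ^ k) sums (mat_exp (t \<cdot>\<^sub>m R) $$ (i,j))"
    if ij: "i < n" "j < n" for i j t
  proof -
    have "(t ^ k \<cdot>\<^sub>m R ^\<^sub>m k) $$ (i,j) = t ^ k * (R ^\<^sub>m k) $$ (i,j)" for k
      using ij carrier_matD[OF pow_carrier_mat[OF R, of k]] by (intro index_smult_mat) auto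
    thus ?thesis using mexp_sums[OF smult_carrier_mat[OF R] ij, of t]
      by (simp add: pow mat_exp_eq_mexp mult.commute)
  qed
  have "((\<lambda>s. mat_exp (s \<cdot>\<^sub>m R) $$ (i,j)) has_real_derivative (R * mat_exp (t \<cdot>\<^sub>m R)) $$ (i,j)) (at t)"
    if ij: "i < n" "j < n" for i j t
  proof -
    let ?c = "\<lambda>k. (R ^\<^sub>m k) $$ (i,j) / fact k"
    have "((\<lambda>s. \<Sum>k. ?c k * s ^ k) has_real_derivative (\<Sum>k. diffs ?c k * t ^ k)) (at t)"
      by (rule termdiffs_strong_converges_everywhere) (use sums[OF ij] sums_summable in blast)
    moreover have "(\<lambda>s. \<Sum>k. ?c k * s ^ k) = (\<lambda>s. mat_exp (s \<cdot>\<^sub>m R) $$ (i,j))"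
      by (intro ext sums_unique[symmetric] sums[OF ij])
    moreover have "(\<Sum>k. diffs ?c k * t ^ k) = (R * mat_exp (t \<cdot>\<^sub>m R)) $$ (i,j)"
    proof -
      \<comment> \<open>Matrix powers unfold with the new factor on the right, whereas the
        differential equation has R on the left.\<close>
      have comm: "R ^\<^sub>m Suc k = R * R ^\<^sub>m k" for k
      proof (induction k)
        case 0
        show ?case using R by simp
      next
        case (Suc k)
        have "R ^\<^sub>m Suc (Suc k) = R * R ^\<^sub>m k * R" using Suc by simp
        also have "\<dots> = R * (R ^\<^sub>m k * R)" by (rule assoc_mult_mat[OF R pow_carrier_mat[OF R] R])
        finally show ?case by simp
      qed
      have "diffs ?c k * t ^ k = (\<Sum>l<n. R $$ (i,l) * ((R ^\<^sub>m k) $$ (l,j) / fact k * t ^ k))" for k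
      proof -
        have "diffs ?c k = (R ^\<^sub>m Suc k) $$ (i,j) / fact k"
          by (simp add: diffs_def fact_Suc del: of_nat_Suc pow_mat.simps)
        also have "(R ^\<^sub>m Suc k) $$ (i,j) = (\<Sum>l<n. R $$ (i,l) * (R ^\<^sub>m k) $$ (l,j))"
          unfolding comm by (rule mult_mat_index_sum[OF R pow_carrier_mat[OF R] ij])
        finally show ?thesis by (simp add: sum_distrib_right sum_divide_distrib mult.assoc)
      qed
      moreover have "(\<lambda>k. \<Sum>l<n. R $$ (i,l) * ((R ^\<^sub>m k) $$ (l,j) / fact k * t ^ k))
          sums (R * mat_exp (t \<cdot>\<^sub>m R)) $$ (i,j)"
        unfolding mult_mat_index_sum[OF R E ij]
        by (intro sums_sum sums_mult sums ij) auto
      ultimately show ?thesis by (simp add: sums_unique[symmetric] del: index_mult_mat)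
    qed
    ultimately show ?thesis by simp
  qed
  thus ?thesis using E unfolding matrix_solution_def by blast
qed

lemma mat_exp_zero:
  assumes R: "R \<in> carrier_mat n n"
  shows "mat_exp (0 \<cdot>\<^sub>m R) = 1\<^sub>m n"
proof (rule eq_matI)
  fix i j assume "i < dim_row (1\<^sub>m n :: real mat)" "j < dim_col (1\<^sub>m n :: real mat)"
  hence ij: "i < n" "j < n" by auto
  have "((0 \<cdot>\<^sub>m R) ^\<^sub>m k) $$ (i,j) / fact k = 0" if k0: "k \<notin> {0}" for k
  proof -
    obtain l where k: "k = Suc l" using k0 by (cases k) auto
    have "(0 \<cdot>\<^sub>m R) ^\<^sub>m l \<in> carrier_mat n n" using R by simp
    from mult_mat_index_sum[OF this smult_carrier_mat[OF R] ij, of 0]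
    show ?thesis using ij R unfolding k by (simp del: index_mult_mat)
  qed
  from suminf_finite[of "{0}", OF _ this]
  show "mat_exp (0 \<cdot>\<^sub>m R) $$ (i,j) = 1\<^sub>m n $$ (i,j)"
    using ij R by (simp add: mat_exp_def)
qed (use R in \<open>auto simp: mat_exp_def\<close>)

lemma mat_exp_carrier [simp]: "R \<in> carrier_mat n m \<Longrightarrow> mat_exp R \<in> carrier_mat n m"
  by (simp add: mat_exp_eq_mexp)

text \<open>A system with constant coefficients admits every time shift, so the left-hand side, as a
  function of s, is a solution with value \<open>mat_exp (t \<cdot>\<^sub>m R)\<close> at s = 0.
  Uniqueness yields the product.\<close>

lemma mat_exp_add_smult:
  assumes R: "R \<in> carrier_mat n n"
  shows "mat_exp ((s + t) \<cdot>\<^sub>m R) = mat_exp (s \<cdot>\<^sub>m R) * mat_exp (t \<cdot>\<^sub>m R)"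
proof -
  have Rc: "continuous_on UNIV (\<lambda>_::real. R $$ (i,j))" for i j by simp
  obtain \<Phi> \<Psi> where \<Phi>: "matrix_solution n (\<lambda>_. R) \<Phi>"
    "\<And>Y t. matrix_solution n (\<lambda>_. R) Y \<Longrightarrow> Y t = \<Phi> t * Y 0"
    by (rule propagator_exists[of "\<lambda>_. R" n, OF R Rc]) blast
  note sol = mat_exp_matrix_solution[OF R]
  have "\<Phi> s \<in> carrier_mat n n" using \<Phi>(1) unfolding matrix_solution_def by simp
  hence \<Phi>s: "\<Phi> s = mat_exp (s \<cdot>\<^sub>m R)" using \<Phi>(2)[OF sol, of s] mat_exp_zero[OF R] by simp
  have "matrix_solution n (\<lambda>_. R) (\<lambda>s. mat_exp ((s + t) \<cdot>\<^sub>m R))"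
    by (rule matrix_solution_shift[OF sol refl])
  from \<Phi>(2)[OF this, of s] show ?thesis unfolding \<Phi>s by simp
qed

lemma mat_exp_inverse:
  assumes R: "R \<in> carrier_mat n n"
  shows "mat_exp (t \<cdot>\<^sub>m R) * mat_exp ((- t) \<cdot>\<^sub>m R) = 1\<^sub>m n"
  using mat_exp_add_smult[OF R, of t "- t"] mat_exp_zero[OF R] by simp

subsection \<open>Real logarithms\<close>

lemma similar_mat_map_hom:
  assumes h: "semiring_hom h" and sim: "similar_mat A B"
  shows "similar_mat (map_mat h A) (map_mat h B)"
proof -
  from similar_matD[OF sim] obtain n P Q where c: "{A,B,P,Q} \<subseteq> carrier_mat n n"
    and PQ: "P * Q = 1\<^sub>m n" and QP: "Q * P = 1\<^sub>m n" and A: "A = P * B * Q" by blast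
  have B: "B \<in> carrier_mat n n" and P: "P \<in> carrier_mat n n" and Q: "Q \<in> carrier_mat n n"
    using c by auto
  note mult = semiring_hom.mat_hom_mult[OF h] and one = semiring_hom.mat_hom_one[OF h, of n]
  show ?thesis
  proof (rule similar_matI[of _ _ "map_mat h P" "map_mat h Q" n])
    show "map_mat h P * map_mat h Q = 1\<^sub>m n" unfolding mult[OF P Q, symmetric] PQ one ..
    show "map_mat h Q * map_mat h P = 1\<^sub>m n" unfolding mult[OF Q P, symmetric] QP one ..
    show "map_mat h A = map_mat h P * map_mat h B * map_mat h Q"
      unfolding A mult[OF mult_carrier_mat[OF P B] Q] mult[OF P B] ..
  qed (use c in auto)
qed

lemma map_cnj_jordan_matrix: "map_mat cnj (jordan_matrix bs) = jordan_matrix (map (apsnd cnj) bs)"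
proof (induction bs)
  case Nil
  show ?case by (rule eq_matI) (auto simp: jordan_matrix_def)
next
  case (Cons b bs)
  obtain k a where b: "b = (k,a)" by force
  have s: "sum_list (map fst (map (apsnd cnj) bs)) = sum_list (map fst bs)"
    by (induction bs) auto
  have blk: "map_mat cnj (jordan_block k a) = jordan_block k (cnj a)"
    by (rule eq_matI) auto
  have z: "map_mat cnj (0\<^sub>m p q) = 0\<^sub>m p q" for p q by (rule eq_matI) auto
  show ?case unfolding b list.map apsnd_conv jordan_matrix_Cons s Cons.IH[symmetric] blk[symmetric]
    by (subst map_four_block_mat[of _ k k _ "sum_list (map fst bs)" _ "sum_list (map fst bs)"])
       (auto simp: z)
qed

text \<open>Entrywise conjugation fixes a real matrix but conjugates the eigenvalues of its Jordan
  form; uniqueness of the blocks identifies the two lists.\<close>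

lemma jordan_nf_real_conjugate_symmetric:
  assumes L: "jordan_nf (map_mat complex_of_real L) bs"
  shows "image_mset (apsnd cnj) (mset bs) = mset bs"
proof -
  have "semiring_hom cnj" by unfold_locales auto
  from similar_mat_map_hom[OF this, of "map_mat complex_of_real L" "jordan_matrix bs"]
  have "similar_mat (map_mat cnj (map_mat complex_of_real L)) (jordan_matrix (map (apsnd cnj) bs))"
    using L unfolding jordan_nf_def map_cnj_jordan_matrix by auto
  also have "map_mat cnj (map_mat complex_of_real L) = map_mat complex_of_real L"
    by (rule eq_matI) auto
  finally have "jordan_nf (map_mat complex_of_real L) (map (apsnd cnj) bs)"
    using L unfolding jordan_nf_def by force
  from jordan_nf_unique_mset[OF this L] show ?thesis by simp
qed

lemma jordan_nf_four_block:
  assumes A: "jordan_nf A xs" and B: "jordan_nf B ys"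
  shows "jordan_nf (four_block_mat A (0\<^sub>m (dim_row A) (dim_row B)) (0\<^sub>m (dim_row B) (dim_row A)) B) (xs @ ys)"
proof -
  note cA = jordan_nf_carrier[OF A] and cB = jordan_nf_carrier[OF B]
  have d: "dim_row A = sum_list (map fst xs)" "dim_row B = sum_list (map fst ys)" using cA cB by auto
  show ?thesis unfolding jordan_nf_def jordan_matrix_append d
    using similar_mat_four_block_0_0[OF _ _ cA cB] A B unfolding jordan_nf_def by auto
qed

lemma jordan_nf_invertible_nonzero:
  fixes A :: "'a :: field mat"
  assumes jnf: "jordan_nf A xs" and d: "det A \<noteq> 0" and mem: "(k,\<mu>) \<in> set xs"
  shows "\<mu> \<noteq> 0"
proof
  assume \<mu>: "\<mu> = 0"
  note A = jordan_nf_carrier[OF jnf]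
  have "k \<noteq> 0" using jnf mem unfolding jordan_nf_def by force
  hence "Polynomial.order 0 (char_poly A) \<noteq> 0"
    using jordan_nf_block_size_order_bound[OF jnf mem] \<mu> by auto
  hence "poly (char_poly A) 0 = 0" by (metis order_0I)
  hence "det (char_matrix A 0) = 0"
    unfolding eigenvalue_root_char_poly[OF A, symmetric] eigenvalue_det[OF A] .
  moreover have "char_matrix A 0 = A" by (rule eq_matI) (use A in \<open>auto simp: char_matrix_def\<close>)
  ultimately show False using d by simp
qed

text \<open>Conjugation permutes the blocks of L that exponentiate to (k, \<mu>), since \<mu> is
  real. None of them is fixed: a real eigenvalue would have a positive exponential.\<close>

lemma real_logarithm_even_count:
  assumes L: "L \<in> carrier_mat n n"
    and jnf: "jordan_nf (map_mat complex_of_real (mexp L)) xs"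
    and \<mu>: "Im \<mu> = 0" "Re \<mu> < 0"
  shows "even (count (mset xs) (k,\<mu>))"
proof -
  let ?e = "apsnd exp :: nat \<times> complex \<Rightarrow> _" and ?g = "apsnd cnj :: nat \<times> complex \<Rightarrow> _"
  have "map_mat complex_of_real L \<in> carrier_mat n n" using L by simp
  from complex_jordan_nf_exists[OF this]
  obtain bs where bs: "jordan_nf (map_mat complex_of_real L) bs" by blast
  note sym = jordan_nf_real_conjugate_symmetric[OF bs]
  have "jordan_nf (map_mat complex_of_real (mexp L)) (map ?e bs)"
    using jordan_nf_mexp[OF bs] unfolding mexp_of_real[OF L] .
  from jordan_nf_unique_mset[OF jnf this]
  have xs: "mset xs = image_mset ?e (mset bs)" by simp
  \<comment> \<open>The blocks of L lying over (k, \<mu>), with multiplicity; exponentiation may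
    send several different blocks there.\<close>
  define F where "F = {#x \<in># mset bs. ?e x = (k,\<mu>)#}"
  have "count (mset xs) (k,\<mu>) = size F"
    unfolding xs count_image_mset' F_def by (auto simp: size_multiset_overloaded_eq intro!: sum.cong)
  moreover have F: "image_mset ?g F = F"
  proof -
    have e: "?e x = (k,\<mu>) \<longleftrightarrow> ?e (?g x) = (k,\<mu>)" for x
    proof -
      have "cnj \<mu> = \<mu>" using \<mu>(1) by (simp add: complex_eq_iff)
      have "exp (cnj z) = \<mu> \<longleftrightarrow> exp z = \<mu>" for z
        using \<open>cnj \<mu> = \<mu>\<close> by (metis complex_cnj_cnj exp_cnj)
      thus ?thesis by (cases x) auto
    qed
    have "image_mset ?g F = image_mset ?g {#x \<in># mset bs. ?e (?g x) = (k,\<mu>)#}"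
      unfolding F_def by (rule arg_cong[of _ _ "image_mset ?g"], rule filter_mset_cong) (use e in auto)
    also have "\<dots> = {#x \<in># image_mset ?g (mset bs). ?e x = (k,\<mu>)#}"
      by (rule image_mset_filter_mset_swap)
    finally show ?thesis unfolding sym F_def .
  qed
  moreover have "even (size F)"
  proof -
    have Im: "Im (snd x) \<noteq> 0" if "x \<in># F" for x
    proof
      assume "Im (snd x) = 0"
      hence "snd x = of_real (Re (snd x))" by (simp add: complex_eq_iff)
      moreover have "exp (snd x) = \<mu>" using that unfolding F_def by (cases x) auto
      ultimately have "\<mu> = of_real (exp (Re (snd x)))" by (metis exp_of_real)
      hence "Re \<mu> > 0" by simp
      thus False using \<mu> by simp
    qed
    \<comment> \<open>Conjugation matches the blocks below the real axis with those above it, so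
      both halves have the same size.\<close>
    have "size F = size {#x \<in># F. Im (snd x) < 0#} + size {#x \<in># F. \<not> Im (snd x) < 0#}"
      by (metis multiset_partition size_union)
    also have "{#x \<in># F. \<not> Im (snd x) < 0#} = {#x \<in># F. Im (snd (?g x)) < 0#}"
      by (rule filter_mset_cong) (use Im in force)+
    also have "size \<dots> = size (image_mset ?g {#x \<in># F. Im (snd (?g x)) < 0#})" by simp
    also have "image_mset ?g {#x \<in># F. Im (snd (?g x)) < 0#} = {#x \<in># F. Im (snd x) < 0#}"
      using image_mset_filter_mset_swap[of ?g "\<lambda>x. Im (snd x) < 0" F] unfolding F .
    finally show ?thesis by simp
  qed
  ultimately show ?thesis by simp
qed

text \<open>Stated for a bare multiset instead of a matrix, so that an induction can remove blocks
  one or two at a time.\<close>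

definition log_symmetric :: "(nat \<times> complex) multiset \<Rightarrow> bool" where
  "log_symmetric X \<longleftrightarrow> (\<forall>k \<mu>. count X (k, cnj \<mu>) = count X (k, \<mu>)) \<and>
     (\<forall>k \<mu>. Im \<mu> = 0 \<longrightarrow> Re \<mu> < 0 \<longrightarrow> even (count X (k, \<mu>))) \<and>
     (\<forall>k \<mu>. (k, \<mu>) \<in># X \<longrightarrow> k \<noteq> 0 \<and> \<mu> \<noteq> 0)"

text \<open>Induction on the number of blocks. A block with positive eigenvalue is removed alone and
  has a real logarithm. Any other block is removed with its conjugate, and the real form of a
  conjugate pair supplies the logarithm.\<close>

lemma real_logarithm_construction:
  assumes "log_symmetric X"
  shows "\<exists>(L :: real mat) bs. jordan_nf (map_mat complex_of_real L) bs \<and>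
    image_mset (apsnd exp) (mset bs) = X"
  using assms
proof (induction "size X" arbitrary: X rule: less_induct)
  case less
  \<comment> \<open>The common induction step: B is a real logarithm for the removed blocks
    \<open>cs\<close>, and it is put in block diagonal form with the logarithm of the rest.\<close>
  have extend: ?case
    if X': "log_symmetric X'" "size X' < size X"
      and B: "jordan_nf (map_mat complex_of_real B) cs" "image_mset (apsnd exp) (mset cs) + X' = X"
    for X' cs and B :: "real mat"
  proof -
    obtain L bs where L: "jordan_nf (map_mat complex_of_real L) bs"
      "image_mset (apsnd exp) (mset bs) = X'"
      using less.hyps[OF X'(2,1)] by blast
    have d: "dim_col B = dim_row B" "dim_col L = dim_row L"
      using carrier_matD[OF jordan_nf_carrier[OF B(1)]] carrier_matD[OF jordan_nf_carrier[OF L(1)]]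
      by simp_all
    let ?N = "four_block_mat B (0\<^sub>m (dim_row B) (dim_row L)) (0\<^sub>m (dim_row L) (dim_row B)) L"
    have "map_mat complex_of_real ?N = four_block_mat (map_mat complex_of_real B)
        (0\<^sub>m (dim_row B) (dim_row L)) (0\<^sub>m (dim_row L) (dim_row B)) (map_mat complex_of_real L)"
      using d by (intro eq_matI) auto
    hence "jordan_nf (map_mat complex_of_real ?N) (cs @ bs)"
      using jordan_nf_four_block[OF B(1) L(1)] by simp
    thus ?thesis using L(2) B(2) by (intro exI[of _ ?N] exI[of _ "cs @ bs"]) auto
  qed
  show ?case
  proof (cases "X = {#}")
    case True
    have "map_mat complex_of_real (0\<^sub>m 0 0) = jordan_matrix []"
      by (rule eq_matI) (auto simp: jordan_matrix_def)
    hence "jordan_nf (map_mat complex_of_real (0\<^sub>m 0 0)) []"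
      using similar_mat_refl[OF jordan_matrix_carrier] unfolding jordan_nf_def by simp
    thus ?thesis using True by (intro exI[of _ "0\<^sub>m 0 0"] exI[of _ "[]"]) auto
  next
    case False
    then obtain x where "x \<in># X" by auto
    then obtain k \<mu> where mem: "(k,\<mu>) \<in># X" by (cases x) auto
    have sym: "count X (l, cnj \<nu>) = count X (l, \<nu>)"
      and ev: "Im \<nu> = 0 \<Longrightarrow> Re \<nu> < 0 \<Longrightarrow> even (count X (l, \<nu>))"
      and nz: "(l,\<nu>) \<in># X \<Longrightarrow> l \<noteq> 0 \<and> \<nu> \<noteq> 0" for l \<nu>
      using less.prems unfolding log_symmetric_def by auto
    have k: "k \<noteq> 0" and \<mu>: "\<mu> \<noteq> 0" using nz[OF mem] by auto
    show ?thesis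
    proof (cases "Im \<mu> = 0 \<and> Re \<mu> > 0")
      case True
      have \<mu>r: "\<mu> = of_real (Re \<mu>)" "cnj \<mu> = \<mu>" using True by (auto simp: complex_eq_iff)
      show ?thesis
      proof (rule extend)
        show "size (X - {#(k,\<mu>)#}) < size X" using mem by (rule size_Diff1_less)
        have c: "cnj \<nu> = \<mu> \<longleftrightarrow> \<nu> = \<mu>" for \<nu> using \<mu>r by (metis complex_cnj_cnj)
        show "log_symmetric (X - {#(k,\<mu>)#})"
          unfolding log_symmetric_def
        proof (intro conjI allI impI)
          fix l \<nu>
          show "count (X - {#(k,\<mu>)#}) (l, cnj \<nu>) = count (X - {#(k,\<mu>)#}) (l, \<nu>)"
            using sym[of l \<nu>] c[of \<nu>] by auto
          show "even (count (X - {#(k,\<mu>)#}) (l, \<nu>))" if "Im \<nu> = 0" "Re \<nu> < 0"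
            using ev[OF that] that True by auto
          assume "(l,\<nu>) \<in># X - {#(k,\<mu>)#}"
          from in_diffD[OF this] show "l \<noteq> 0" "\<nu> \<noteq> 0" using nz by auto
        qed
        let ?B = "jordan_block k (ln (Re \<mu>))" and ?c = "[(k, complex_of_real (ln (Re \<mu>)))]"
        have "map_mat complex_of_real ?B = jordan_matrix ?c"
          unfolding jordan_matrix_def by (auto intro!: eq_matI)
        thus "jordan_nf (map_mat complex_of_real ?B) ?c"
          using k similar_mat_refl[OF jordan_matrix_carrier] unfolding jordan_nf_def by auto
        have "exp (complex_of_real (ln (Re \<mu>))) = \<mu>"
          using True \<mu>r(1) by (metis exp_ln exp_of_real)
        thus "image_mset (apsnd exp) (mset ?c) + (X - {#(k,\<mu>)#}) = X"
          using mem by simp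
      qed
    next
      case False
      let ?Y = "{#(k,\<mu>), (k,cnj \<mu>)#}"
      have mem': "(k, cnj \<mu>) \<in># X" using mem sym[of k \<mu>] by (metis count_eq_zero_iff)
      \<comment> \<open>For negative \<mu> the pair consists of two copies of one block; even
        multiplicity guarantees that the second copy exists.\<close>
      have sub: "?Y \<subseteq># X"
      proof (cases "Im \<mu> = 0")
        case True
        hence c: "cnj \<mu> = \<mu>" by (simp add: complex_eq_iff)
        have "Re \<mu> < 0" using True False \<mu> by (metis complex_eqI linorder_neqE_linordered_idom zero_complex.sel)
        from ev[OF True this, of k] mem have "count X (k,\<mu>) \<ge> 2"
          by (metis count_greater_zero_iff dvd_imp_le)
        thus ?thesis unfolding c by (auto simp: subseteq_mset_def)
      next
        case False
        hence "cnj \<mu> \<noteq> \<mu>" by (simp add: complex_eq_iff)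
        thus ?thesis using mem mem' by (auto simp: subseteq_mset_def Suc_le_eq)
      qed
      show ?thesis
      proof (rule extend)
        have "size X = size ?Y + size (X - ?Y)"
          using sub by (metis size_union subset_mset.add_diff_inverse)
        thus "size (X - ?Y) < size X" by simp
        have c: "cnj \<nu> = \<mu> \<longleftrightarrow> \<nu> = cnj \<mu>" for \<nu> by (metis complex_cnj_cnj)
        show "log_symmetric (X - ?Y)"
          unfolding log_symmetric_def
        proof (intro conjI allI impI)
          fix l \<nu>
          show "count (X - ?Y) (l, cnj \<nu>) = count (X - ?Y) (l, \<nu>)"
            using sym[of l \<nu>] c[of \<nu>] by auto
          show "even (count (X - ?Y) (l, \<nu>))" if "Im \<nu> = 0" "Re \<nu> < 0"
          proof -
            have "cnj \<nu> = \<nu>" using that by (simp add: complex_eq_iff)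
            thus ?thesis using ev[OF that, of l] c[of \<nu>] by auto
          qed
          assume "(l,\<nu>) \<in># X - ?Y"
          from in_diffD[OF this] show "l \<noteq> 0" "\<nu> \<noteq> 0" using nz by auto
        qed
        \<comment> \<open>For negative \<mu> the principal logarithm has imaginary part pi, so it
          and its conjugate are two different logarithms of the same \<mu>.\<close>
        define a b where "a = Re (Ln \<mu>)" and "b = Im (Ln \<mu>)"
        have ab: "Complex a b = Ln \<mu>" by (simp add: a_def b_def)
        let ?B = "four_block_mat (jordan_block k a) ((-b) \<cdot>\<^sub>m 1\<^sub>m k) (b \<cdot>\<^sub>m 1\<^sub>m k) (jordan_block k a)"
        let ?c = "[(k, Complex a b), (k, cnj (Complex a b))]"
        show "jordan_nf (map_mat complex_of_real ?B) ?c"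
          using k complexification_similar_conjugate_blocks[of k a b] unfolding jordan_nf_def by auto
        have "exp (cnj (Ln \<mu>)) = cnj \<mu>" using \<mu> by (metis exp_cnj exp_Ln)
        hence "image_mset (apsnd exp) (mset ?c) = ?Y" using \<mu> unfolding ab by simp
        thus "image_mset (apsnd exp) (mset ?c) + (X - ?Y) = X" using subset_mset.add_diff_inverse[OF sub] by (simp only:)
      qed
    qed
  qed
qed

section \<open>Similarity invariance and the criterion for a real logarithm\<close>

lemma mexp_similar_image:
  assumes "similar_mat M (mexp L)" "L \<in> carrier_mat n n"
  shows "\<exists>L' \<in> carrier_mat n n. mexp L' = M"
proof -
  from assms obtain P Q where wit: "similar_mat_wit M (mexp L) P Q" unfolding similar_mat_def by auto
  have M: "M \<in> carrier_mat n n"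
    using similar_mat_witD(4,5)[OF refl wit] mexp_carrier[OF assms(2)] by (metis carrier_matD(1))
  note w = similar_mat_witD2[OF M wit]
  have "similar_mat_wit (P * L * Q) L P Q"
    by (rule similar_mat_witI[OF w(1,2) refl]) (use w assms in auto)
  from similar_mat_witD(3)[OF refl mexp_similar_wit[OF this]]
  have "mexp (P * L * Q) = M" unfolding w(3) .
  thus ?thesis using w assms by (intro bexI[of _ "P * L * Q"]) auto
qed

lemma real_logarithm_iff:
  assumes M: "M \<in> carrier_mat n n" and d: "det M \<noteq> 0"
    and jnf: "jordan_nf (map_mat complex_of_real M) xs"
  shows "(\<exists>L \<in> carrier_mat n n. mexp L = M) \<longleftrightarrow>
    (\<forall>k \<mu>. Im \<mu> = 0 \<longrightarrow> Re \<mu> < 0 \<longrightarrow> even (count (mset xs) (k, \<mu>)))"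
proof
  assume "\<exists>L \<in> carrier_mat n n. mexp L = M"
  thus "\<forall>k \<mu>. Im \<mu> = 0 \<longrightarrow> Re \<mu> < 0 \<longrightarrow> even (count (mset xs) (k, \<mu>))"
    using real_logarithm_even_count jnf by blast
next
  assume ev: "\<forall>k \<mu>. Im \<mu> = 0 \<longrightarrow> Re \<mu> < 0 \<longrightarrow> even (count (mset xs) (k, \<mu>))"
  have "count (mset xs) (k, cnj \<mu>) = count (mset xs) (k, \<mu>)" for k \<mu>
  proof -
    have inj: "inj (apsnd cnj :: nat \<times> complex \<Rightarrow> _)"
      by (rule injI) (auto simp: prod_eq_iff)
    have "count (image_mset (apsnd cnj) (mset xs)) (apsnd cnj (k,\<mu>)) = count (mset xs) (k,\<mu>)"
      by (induction xs) (auto simp: inj_eq[OF inj])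
    thus ?thesis unfolding jordan_nf_real_conjugate_symmetric[OF jnf] by simp
  qed
  moreover have "k \<noteq> 0 \<and> \<mu> \<noteq> 0" if "(k,\<mu>) \<in># mset xs" for k \<mu>
  proof -
    have "comm_ring_hom complex_of_real" by unfold_locales auto
    from comm_ring_hom.hom_det[OF this, of M]
    have "det (map_mat complex_of_real M) \<noteq> 0" using d by simp
    thus ?thesis using that jordan_nf_invertible_nonzero[OF jnf] jnf unfolding jordan_nf_def by force
  qed
  ultimately have "log_symmetric (mset xs)" using ev unfolding log_symmetric_def by blast
  from real_logarithm_construction[OF this] obtain L :: "real mat" and bs
    where L: "jordan_nf (map_mat complex_of_real L) bs" "image_mset (apsnd exp) (mset bs) = mset xs"
    by blast
  define N where "N = sum_list (map fst bs)"
  have cL: "L \<in> carrier_mat N N"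
    using carrier_matD[OF jordan_nf_carrier[OF L(1)]] unfolding N_def by (intro carrier_matI) simp_all
  have "jordan_nf (map_mat complex_of_real (mexp L)) (map (apsnd exp) bs)"
    using jordan_nf_mexp[OF L(1)] unfolding mexp_of_real[OF cL] .
  \<comment> \<open>The construction controls the blocks only as a multiset, so they are reordered
    into the list \<open>xs\<close>.\<close>
  from jordan_nf_mset[OF this] L(2)
  have jL: "jordan_nf (map_mat complex_of_real (mexp L)) xs" by simp
  have "dim_row M = sum_list (map fst xs)" "dim_row (mexp L) = sum_list (map fst xs)"
    using jordan_nf_carrier[OF jnf] jordan_nf_carrier[OF jL] by auto
  \<comment> \<open>The size of the constructed L was left open; it follows from the equal block
    lists of M and its candidate.\<close>
  hence "N = n" using M mexp_carrier[OF cL] by auto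
  hence cL: "L \<in> carrier_mat n n" using cL by simp
  have "similar_mat (map_mat complex_of_real M) (map_mat complex_of_real (mexp L))"
    using jnf jL similar_mat_sym similar_mat_trans unfolding jordan_nf_def by blast
  from similar_mat_of_complex_similar[OF M mexp_carrier[OF cL] this] cL
  show "\<exists>L \<in> carrier_mat n n. mexp L = M" by (rule mexp_similar_image)
qed

subsection \<open>Floquet normal forms\<close>

lemma invertible_mat_inverse:
  assumes "invertible_mat M" "M \<in> carrier_mat n n"
  shows "\<exists>N. N \<in> carrier_mat n n \<and> M * N = 1\<^sub>m n \<and> N * M = 1\<^sub>m n"
proof -
  from assms obtain N where N: "M * N = 1\<^sub>m n" "N * M = 1\<^sub>m (dim_row N)"
    unfolding invertible_mat_def inverts_mat_def by auto
  \<comment> \<open>\<open>invertible_mat\<close> does not prescribe the format of the inverse;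
    comparing column numbers in the two products determines it.\<close>
  have "dim_col N = n" using arg_cong[OF N(1), of dim_col] by simp
  moreover have "dim_row N = n" using arg_cong[OF N(2), of dim_col] assms(2) by simp
  ultimately have "N \<in> carrier_mat n n" by auto
  thus ?thesis using N \<open>dim_row N = n\<close> by auto
qed

lemma invertible_matI:
  assumes "M \<in> carrier_mat n n" "N \<in> carrier_mat n n" "M * N = 1\<^sub>m n" "N * M = 1\<^sub>m n"
  shows "invertible_mat M"
  using assms unfolding invertible_mat_def inverts_mat_def by (auto intro!: exI[of _ N])

lemma mat_inv_eq:
  assumes M: "M \<in> carrier_mat n n" and N: "N \<in> carrier_mat n n"
    and MN: "M * N = 1\<^sub>m n" and NM: "N * M = 1\<^sub>m n"
  shows "mat_inv n M = N"
  unfolding mat_inv_def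
proof (rule the_equality)
  fix K assume K: "K \<in> carrier_mat n n \<and> M * K = 1\<^sub>m n \<and> K * M = 1\<^sub>m n"
  have "N * M * K = N * (M * K)" using assoc_mult_mat[OF N M] K by blast
  moreover have "1\<^sub>m n * K = K" "N * 1\<^sub>m n = N" using K N by auto
  ultimately show "K = N" using K NM by simp
qed (use assms in auto)

lemma fundamental_matrix_iff:
  "fundamental_matrix n A \<Phi> \<longleftrightarrow> matrix_solution n A \<Phi> \<and> (\<forall>t. invertible_mat (\<Phi> t))"
  unfolding fundamental_matrix_def matrix_solution_def by auto

text \<open>The common core of (b) and (c): it is the conclusion of (c) for a single \<Phi>, and (b)
  says that some fundamental matrix has this form.\<close>

definition floquet_form :: "nat \<Rightarrow> real \<Rightarrow> (real \<Rightarrow> real mat) \<Rightarrow> bool" where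
  "floquet_form n T \<Phi> \<longleftrightarrow> (\<exists>P B. B \<in> carrier_mat n n \<and> (\<forall>t. P t \<in> carrier_mat n n) \<and>
     (\<forall>t. P (t + T) = P t) \<and> (\<forall>t. \<Phi> t = P t * mat_exp (t \<cdot>\<^sub>m B)))"

text \<open>Evaluating the form at 0 and T identifies the monodromy matrix with exp (T B).
  Conversely, a logarithm L forces the choice B = L / T and P(t) = \<Phi>(t) exp (-t B), which is
  periodic because the monodromy factor cancels against exp (-T B).\<close>

lemma floquet_form_iff_monodromy_logarithm:
  assumes T: "T > 0" and \<Phi>: "fundamental_matrix n A \<Phi>"
    and mono: "\<And>t. \<Phi> (t + T) = \<Phi> t * monodromy n \<Phi> T"
  shows "floquet_form n T \<Phi> \<longleftrightarrow> (\<exists>L \<in> carrier_mat n n. mexp L = monodromy n \<Phi> T)"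
proof
  have \<Phi>c: "\<Phi> t \<in> carrier_mat n n" for t using \<Phi> unfolding fundamental_matrix_def by auto
  have inv: "invertible_mat (\<Phi> t)" for t using \<Phi> unfolding fundamental_matrix_def by auto
  obtain V where V: "V \<in> carrier_mat n n" "\<Phi> 0 * V = 1\<^sub>m n" "V * \<Phi> 0 = 1\<^sub>m n"
    using invertible_mat_inverse[OF inv \<Phi>c, of 0] by blast
  have mon: "monodromy n \<Phi> T = V * \<Phi> T"
    unfolding monodromy_def mat_inv_eq[OF \<Phi>c V] ..
  {
    assume "floquet_form n T \<Phi>"
    then obtain P B where B: "B \<in> carrier_mat n n" and P: "\<And>t. P t \<in> carrier_mat n n"
      "\<And>t. P (t + T) = P t" and eq: "\<And>t. \<Phi> t = P t * mat_exp (t \<cdot>\<^sub>m B)"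
      unfolding floquet_form_def by blast
    have E: "mat_exp (T \<cdot>\<^sub>m B) \<in> carrier_mat n n" using B by simp
    have "\<Phi> 0 = P 0" using eq[of 0] mat_exp_zero[OF B] P(1)[of 0] by simp
    hence "\<Phi> T = \<Phi> 0 * mat_exp (T \<cdot>\<^sub>m B)" using eq[of T] P(2)[of 0] by simp
    hence "monodromy n \<Phi> T = V * (\<Phi> 0 * mat_exp (T \<cdot>\<^sub>m B))" unfolding mon by simp
    also have "\<dots> = V * \<Phi> 0 * mat_exp (T \<cdot>\<^sub>m B)"
      by (rule assoc_mult_mat[OF V(1) \<Phi>c E, symmetric])
    also have "\<dots> = mat_exp (T \<cdot>\<^sub>m B)" using V(3) E by simp
    finally show "\<exists>L \<in> carrier_mat n n. mexp L = monodromy n \<Phi> T"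
      using B unfolding mat_exp_eq_mexp by (intro bexI[of _ "T \<cdot>\<^sub>m B"]) auto
  next
    assume "\<exists>L \<in> carrier_mat n n. mexp L = monodromy n \<Phi> T"
    then obtain L where L: "L \<in> carrier_mat n n" "mat_exp L = monodromy n \<Phi> T"
      unfolding mat_exp_eq_mexp by blast
    define B where "B = (1 / T) \<cdot>\<^sub>m L"
    have B: "B \<in> carrier_mat n n" using L unfolding B_def by simp
    have "T \<cdot>\<^sub>m B = L" unfolding B_def using T L by (intro eq_matI) auto
    hence EM: "mat_exp (T \<cdot>\<^sub>m B) = monodromy n \<Phi> T" using L by simp
    have E: "mat_exp (t \<cdot>\<^sub>m B) \<in> carrier_mat n n" for t using B by simp
    define P where "P = (\<lambda>t. \<Phi> t * mat_exp ((- t) \<cdot>\<^sub>m B))"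
    have "P t \<in> carrier_mat n n" for t using \<Phi>c[of t] E[of "- t"] unfolding P_def by simp
    moreover have "P (t + T) = P t" for t
    proof -
      have "P (t + T) = \<Phi> t * mat_exp (T \<cdot>\<^sub>m B) * mat_exp ((- (t + T)) \<cdot>\<^sub>m B)"
        unfolding P_def mono EM ..
      also have "\<dots> = \<Phi> t * (mat_exp (T \<cdot>\<^sub>m B) * mat_exp ((- (t + T)) \<cdot>\<^sub>m B))"
        by (rule assoc_mult_mat[OF \<Phi>c E E])
      also have "\<dots> = P t"
        unfolding P_def mat_exp_add_smult[OF B, symmetric] by simp
      finally show ?thesis .
    qed
    moreover have "\<Phi> t = P t * mat_exp (t \<cdot>\<^sub>m B)" for t
    proof -
      have "P t * mat_exp (t \<cdot>\<^sub>m B) = \<Phi> t * (mat_exp ((- t) \<cdot>\<^sub>m B) * mat_exp (t \<cdot>\<^sub>m B))"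
        unfolding P_def by (rule assoc_mult_mat[OF \<Phi>c E E])
      also have "\<dots> = \<Phi> t" using mat_exp_inverse[OF B, of "- t"] \<Phi>c[of t] by simp
      finally show ?thesis ..
    qed
    ultimately show "floquet_form n T \<Phi>" using B unfolding floquet_form_def by blast
  }
qed

text \<open>Blocks of a Jordan normal form have positive size, so the sum vanishes only when no
  block is counted; a pair absent from the list has the even count 0.\<close>

lemma jnf_A_index_eq_0_iff:
  assumes "jordan_nf M xs"
  shows "jnf_A_index xs = 0 \<longleftrightarrow>
    (\<forall>k \<mu>. Im \<mu> = 0 \<longrightarrow> Re \<mu> < 0 \<longrightarrow> even (count (mset xs) (k, \<mu>)))"
proof -
  define S where
    "S = {b \<in> set xs. Im (snd b) = 0 \<and> Re (snd b) < 0 \<and> odd (count (mset xs) b)}"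
  have "finite S" unfolding S_def by simp
  hence "jnf_A_index xs = 0 \<longleftrightarrow> (\<forall>b\<in>S. fst b = 0)"
    unfolding jnf_A_index_def S_def[symmetric] by (rule sum_eq_0_iff)
  also have "\<dots> \<longleftrightarrow> S = {}"
  proof -
    have "\<forall>b\<in>S. fst b \<noteq> 0" using assms unfolding S_def jordan_nf_def by force
    thus ?thesis by blast
  qed
  also have "\<dots> \<longleftrightarrow> (\<forall>k \<mu>. Im \<mu> = 0 \<longrightarrow> Re \<mu> < 0 \<longrightarrow> even (count (mset xs) (k, \<mu>)))"
  proof -
    have "b \<in> set xs" if "odd (count (mset xs) b)" for b
      using that by (metis count_eq_zero_iff dvd_0_right set_mset_mset)
    thus ?thesis unfolding S_def by auto
  qed
  finally show ?thesis .
qed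

text \<open>Every fundamental matrix is \<open>\<Phi>\<^sub>0 t * \<Phi> 0\<close>, so its monodromy
  matrix is the conjugate of \<open>\<Phi>\<^sub>0 T\<close> by \<Phi>(0). The shift relation holds
  because \<Phi>(t + T) is again a solution, with initial value \<Phi>(T).\<close>

lemma monodromy_via_propagator:
  assumes per: "\<And>t. A (t + T) = A t"
    and gen: "\<forall>Y t. matrix_solution n A Y \<longrightarrow> Y t = \<Phi>\<^sub>0 t * Y 0"
    and \<Phi>\<^sub>0: "\<And>t. \<Phi>\<^sub>0 t \<in> carrier_mat n n" and \<Phi>: "fundamental_matrix n A \<Phi>"
  shows "monodromy n \<Phi> T \<in> carrier_mat n n" and "\<Phi> (t + T) = \<Phi> t * monodromy n \<Phi> T"
    and "similar_mat (monodromy n \<Phi> T) (\<Phi>\<^sub>0 T)" and "det (monodromy n \<Phi> T) \<noteq> 0"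
proof -
  have \<Phi>c: "\<Phi> t \<in> carrier_mat n n" for t using \<Phi> unfolding fundamental_matrix_def by auto
  have inv: "\<exists>V. V \<in> carrier_mat n n \<and> \<Phi> t * V = 1\<^sub>m n \<and> V * \<Phi> t = 1\<^sub>m n" for t
    using \<Phi> unfolding fundamental_matrix_def by (intro invertible_mat_inverse \<Phi>c) simp
  obtain V where V: "V \<in> carrier_mat n n" "\<Phi> 0 * V = 1\<^sub>m n" "V * \<Phi> 0 = 1\<^sub>m n" using inv by blast
  obtain W where W: "W \<in> carrier_mat n n" "\<Phi> T * W = 1\<^sub>m n" using inv by blast
  have mon: "monodromy n \<Phi> T = V * \<Phi> T"
    unfolding monodromy_def mat_inv_eq[OF \<Phi>c V] ..
  show "monodromy n \<Phi> T \<in> carrier_mat n n" unfolding mon using V \<Phi>c by simp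
  have sol: "matrix_solution n A \<Phi>" using \<Phi> unfolding fundamental_matrix_iff by simp
  have "\<Phi> (t + T) = \<Phi>\<^sub>0 t * \<Phi> T"
    using gen[rule_format, OF matrix_solution_shift[OF sol per]] by simp
  also have "\<Phi> T = \<Phi> 0 * (V * \<Phi> T)"
    using assoc_mult_mat[OF \<Phi>c[of 0] V(1) \<Phi>c[of T]] V(2) \<Phi>c[of T] by simp
  also have "\<Phi>\<^sub>0 t * (\<Phi> 0 * (V * \<Phi> T)) = \<Phi>\<^sub>0 t * \<Phi> 0 * (V * \<Phi> T)"
    by (rule assoc_mult_mat[OF \<Phi>\<^sub>0 \<Phi>c mult_carrier_mat[OF V(1) \<Phi>c], symmetric])
  finally show "\<Phi> (t + T) = \<Phi> t * monodromy n \<Phi> T"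
    unfolding mon gen[rule_format, OF sol, of t, symmetric] .
  have "V * \<Phi> T = V * \<Phi>\<^sub>0 T * \<Phi> 0"
    using gen[rule_format, OF sol, of T] assoc_mult_mat[OF V(1) \<Phi>\<^sub>0[of T] \<Phi>c[of 0]] by simp
  thus "similar_mat (monodromy n \<Phi> T) (\<Phi>\<^sub>0 T)" unfolding mon
    by (intro similar_matI[OF _ V(3,2)]) (use V(1) \<Phi>c[of 0] \<Phi>\<^sub>0[of T] mult_carrier_mat in auto)
  have "det V * det (\<Phi> 0) = 1" using det_mult[OF V(1) \<Phi>c[of 0]] V(3) by simp
  moreover have "det (\<Phi> T) * det W = 1" using det_mult[OF \<Phi>c[of T] W(1)] W(2) by simp
  ultimately show "det (monodromy n \<Phi> T) \<noteq> 0" unfolding mon det_mult[OF V(1) \<Phi>c[of T]] by auto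
qed

theorem theorem5p1:
  fixes n :: nat and T :: real and A :: "real \<Rightarrow> real mat"
  assumes T_pos: "T > 0"
    and A_dim: "\<forall>t. A t \<in> carrier_mat n n"
    and A_cont: "\<forall>i j. i < n \<longrightarrow> j < n \<longrightarrow> continuous_on UNIV (\<lambda>t. A t $$ (i,j))"
    and A_per: "\<forall>t. A (t + T) = A t"
  shows "(A_index n A T = 0
          \<longleftrightarrow> (\<exists>R Q. R \<in> carrier_mat n n \<and> (\<forall>t. Q t \<in> carrier_mat n n) \<and>
                   (\<forall>t. Q (t + T) = Q t) \<and>
                   fundamental_matrix n A (\<lambda>t. Q t * mat_exp (t \<cdot>\<^sub>m R))))
       \<and> ((\<exists>R Q. R \<in> carrier_mat n n \<and> (\<forall>t. Q t \<in> carrier_mat n n) \<and>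
                   (\<forall>t. Q (t + T) = Q t) \<and>
                   fundamental_matrix n A (\<lambda>t. Q t * mat_exp (t \<cdot>\<^sub>m R)))
          \<longleftrightarrow> (\<forall>\<Phi>. fundamental_matrix n A \<Phi> \<longrightarrow>
                 (\<exists>P B. B \<in> carrier_mat n n \<and> (\<forall>t. P t \<in> carrier_mat n n) \<and>
                        (\<forall>t. P (t + T) = P t) \<and>
                        (\<forall>t. \<Phi> t = P t * mat_exp (t \<cdot>\<^sub>m B)))))"
    (is "(_ \<longleftrightarrow> ?b) \<and> (?b \<longleftrightarrow> ?c)")
proof -
  have A: "\<And>t. A t \<in> carrier_mat n n" and per: "\<And>t. A (t + T) = A t"
    and cont: "\<And>i j. i < n \<Longrightarrow> j < n \<Longrightarrow> continuous_on UNIV (\<lambda>t. A t $$ (i,j))"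
    using A_dim A_cont A_per by auto
  obtain \<Phi>\<^sub>0 \<Psi>\<^sub>0 where sol: "matrix_solution n A \<Phi>\<^sub>0" "\<Phi>\<^sub>0 0 = 1\<^sub>m n"
    and \<Psi>\<^sub>0: "\<And>t. \<Psi>\<^sub>0 t \<in> carrier_mat n n"
    "\<And>t. \<Phi>\<^sub>0 t * \<Psi>\<^sub>0 t = 1\<^sub>m n" "\<And>t. \<Psi>\<^sub>0 t * \<Phi>\<^sub>0 t = 1\<^sub>m n"
    and gen: "\<And>Y t. matrix_solution n A Y \<Longrightarrow> Y t = \<Phi>\<^sub>0 t * Y 0"
    by (rule propagator_exists[OF A cont], assumption, assumption, rule that)
  have \<Phi>\<^sub>0c: "\<Phi>\<^sub>0 t \<in> carrier_mat n n" for t using sol unfolding matrix_solution_def by simp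
  have fund0: "fundamental_matrix n A \<Phi>\<^sub>0"
    using sol invertible_matI[OF \<Phi>\<^sub>0c \<Psi>\<^sub>0] unfolding fundamental_matrix_iff by blast
  have gen': "\<forall>Y t. matrix_solution n A Y \<longrightarrow> Y t = \<Phi>\<^sub>0 t * Y 0" using gen by blast
  note mon = monodromy_via_propagator[where A = A and T = T and n = n and \<Phi>\<^sub>0 = \<Phi>\<^sub>0, OF per gen' \<Phi>\<^sub>0c]
  \<comment> \<open>The pivot of the proof: (a), (b) and (c) are each shown equivalent to D.
    Similarity of all monodromy matrices to \<open>\<Phi>\<^sub>0 T\<close> makes D independent of
    the fundamental matrix.\<close>
  define D where "D \<longleftrightarrow> (\<exists>L \<in> carrier_mat n n. mexp L = \<Phi>\<^sub>0 T)"
  have log: "(\<exists>L \<in> carrier_mat n n. mexp L = monodromy n \<Phi> T) \<longleftrightarrow> D"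
    if "fundamental_matrix n A \<Phi>" for \<Phi>
    using mon(3)[OF that] mexp_similar_image similar_mat_sym unfolding D_def by metis
  have floquet: "floquet_form n T \<Phi> \<longleftrightarrow> D" if "fundamental_matrix n A \<Phi>" for \<Phi>
    using floquet_form_iff_monodromy_logarithm[OF T_pos that mon(2)[OF that]] log[OF that] by simp
  have b: "?b \<longleftrightarrow> D"
  proof
    assume ?b
    then obtain R Q where RQ: "R \<in> carrier_mat n n" "\<forall>t. Q t \<in> carrier_mat n n"
      "\<forall>t. Q (t + T) = Q t" "fundamental_matrix n A (\<lambda>t. Q t * mat_exp (t \<cdot>\<^sub>m R))" by blast
    hence "floquet_form n T (\<lambda>t. Q t * mat_exp (t \<cdot>\<^sub>m R))" unfolding floquet_form_def by blast
    thus D using floquet[OF RQ(4)] by simp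
  next
    assume D
    hence "floquet_form n T \<Phi>\<^sub>0" using floquet[OF fund0] by simp
    then obtain P B where PB: "B \<in> carrier_mat n n" "\<forall>t. P t \<in> carrier_mat n n"
      "\<forall>t. P (t + T) = P t" "\<forall>t. \<Phi>\<^sub>0 t = P t * mat_exp (t \<cdot>\<^sub>m B)"
      unfolding floquet_form_def by blast
    have "\<Phi>\<^sub>0 = (\<lambda>t. P t * mat_exp (t \<cdot>\<^sub>m B))" using PB(4) by blast
    thus ?b using PB(1-3) fund0 by (intro exI[of _ B] exI[of _ P]) simp
  qed
  \<comment> \<open>Passing from the universal statement to D needs at least one fundamental matrix,
    which \<open>fund0\<close> supplies.\<close>
  have c: "?c \<longleftrightarrow> D"
    using floquet fund0 unfolding floquet_form_def[symmetric] by blast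
  \<comment> \<open>The two choices made in \<open>A_index\<close> are named here. Both describe
    existing objects: \<open>fund0\<close> gives a fundamental matrix, and every complex square
    matrix has a Jordan normal form.\<close>
  define \<Phi> where "\<Phi> = (SOME \<Phi>. fundamental_matrix n A \<Phi>)"
  have fund: "fundamental_matrix n A \<Phi>" unfolding \<Phi>_def by (rule someI[of "fundamental_matrix n A", OF fund0])
  define xs where "xs = (SOME xs. jordan_nf (map_mat complex_of_real (monodromy n \<Phi> T)) xs)"
  have "map_mat complex_of_real (monodromy n \<Phi> T) \<in> carrier_mat n n"
    using mon(1)[OF fund] by simp
  from someI_ex[OF complex_jordan_nf_exists[OF this]]
  have xs: "jordan_nf (map_mat complex_of_real (monodromy n \<Phi> T)) xs" unfolding xs_def .
  have "A_index n A T = jnf_A_index xs"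
    unfolding A_index_def Let_def \<Phi>_def xs_def ..
  hence "A_index n A T = 0 \<longleftrightarrow> D"
    unfolding log[OF fund, symmetric] real_logarithm_iff[OF mon(1,4)[OF fund] xs]
    using jnf_A_index_eq_0_iff[OF xs] by simp
  with b c show ?thesis by simp
qed

end
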